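(* Let $\mathcal{S}\subset\mathbb{R}^{n_1\times 1\times n_3}$ be the $n_2$-dimensional tensor-column subspace spanned by the columns of $\mathcal{U}\in\mathbb{R}^{n_1\times n_2\times n_3}$ with $\mathcal{U}^{\dagger}\bullet\mathcal{U}=\mathcal{I}$, let $\mathcal{P}$ be the orthogonal projection onto $\mathcal{S}$ and $\mu(\mathcal{S})$ its coherence. Let $\mathcal{T}\in\mathbb{R}^{n_1\times 1\times n_3}$ and write $\mathcal{T}=\mathcal{X}+\mathcal{Y}$ with $\mathcal{X}\in\mathcal{S}$, $\mathcal{Y}\in\mathcal{S}^{\bot}$. Let $\Omega$ be a tubal sample of size $m$ drawn uniformly with replacement from $\{1,\dots,n_1\}$. Let $\delta>0$ and $m\ge \frac{8}{3}n_2\mu(\mathcal{S})\log\left(\frac{2n_2n_3}{\delta}\right)$. Then with probability at least $1-4\delta$, $$\frac{m(1-\alpha)-c^2n_2\mu(\mathcal{S})\frac{\beta}{(1-\gamma)}}{n_1}\left\|\mathcal{T}-\mathcal{P}\bullet\mathcal{T}\right\|_F^2\le\left\|\mathcal{T}_{\Omega}-\mathcal{P}_{\Omega}\bullet\mathcal{T}_{\Omega}\right\|_F^2\le(1+\alpha)\frac{m}{n_1}\left\|\mathcal{T}-\mathcal{P}\bullet\mathcal{T}\right\|_F^2$$ holds, where $$\alpha=\sqrt{\frac{2(n_1\|\mathcal{Y}\|_{\infty^*}^2-\|\mathcal{Y}\|_F^2)}{m\|\mathcal{Y}\|_F^2}\log\left(\tfrac{1}{\delta}\right)}+\frac{2(n_1\|\mathcal{Y}\|_{\infty^*}^2-\|\mathcal{Y}\|_F^2)}{3m\|\mathcal{Y}\|_F^2}\log\left(\tfrac{1}{\delta}\right),$$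 $$\beta=\left(1+2\sqrt{\log\left(\tfrac{1}{\delta}\right)}\right)^2,\qquad \gamma=\sqrt{\frac{8c^2n_2\mu(\mathcal{S})}{3m}\log\left(\frac{2n_2n_3}{\delta}\right)}.$$
   Context: Transform and products. $\mathcal{L}:\mathbb{R}^{1\times1\times n_3}\to\mathbb{R}^{1\times1\times n_3}$ is an invertible linear transform on tubes given by an $n_3\times n_3$ matrix $\bm{M}$: $\mathcal{L}(\bm{a})(1,1,i)=(\bm{M}\,\mathrm{vec}(\bm{a}))_i$. It is taken that $\|\mathcal{L}(\bm{a})\|_F=c\|\bm{a}\|_F$ for tubes $\bm{a}$, where $c$ is a constant with $0<c\le\|\bm{M}\|$ (spectral norm). The tube product is $\bm{a}\bullet\bm{b}=\mathcal{L}^{-1}(\mathcal{L}(\bm{a})\circ\mathcal{L}(\bm{b}))$, where $\circ$ is the entrywise product. For $\mathcal{A}\in\mathbb{R}^{n_1\times n_2\times n_3}$ and $\mathcal{B}\in\mathbb{R}^{n_2\times n_4\times n_3}$, $\mathcal{A}\bullet\mathcal{B}\in\mathbb{R}^{n_1\times n_4\times n_3}$ has tubes $(\mathcal{A}\bullet\mathcal{B})(i,j,:)=\sum_{s=1}^{n_2}\mathcal{A}(i,s,:)\bullet\mathcal{B}(s,j,:)$. $\mathcal{L}(\mathcal{A})$ is obtained by applying $\mathcal{L}$ to every tube $\mathcal{A}(i,j,:)$, and $\mathcal{A}^{(k)}=\mathcal{A}(:,:,k)$ is the $k$-th frontal slice. The transpose $\mathcal{A}^{\dagger}$ is defined by $\mathcal{L}(\mathcal{A}^{\dagger})^{(k)}=(\mathcal{L}(\mathcal{A})^{(k)})^H$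 for all $k$. With $\bm{e}=\mathcal{L}^{-1}(\bm{1})$ ($\bm{1}$ the all-ones tube), the identity tensor $\mathcal{I}$ has $\bm{e}$ as each diagonal tube and zero tubes elsewhere; inverses are with respect to $\bullet$ and $\mathcal{I}$. Subspaces. The tensor-column subspace spanned by the columns $\mathcal{U}_j=\mathcal{U}(:,j,:)$ is $\mathcal{S}=\{\sum_{j}\mathcal{U}_j\bullet\bm{c}_j:\bm{c}_j \text{ arbitrary tubes of length } n_3\}$. The orthogonal projection onto $\mathcal{S}$ is $\mathcal{P}=\mathcal{U}\bullet(\mathcal{U}^{\dagger}\bullet\mathcal{U})^{-1}\bullet\mathcal{U}^{\dagger}$, and $\mathcal{S}^{\bot}=\{\mathcal{Y}\in\mathbb{R}^{n_1\times 1\times n_3}:\mathcal{U}^{\dagger}\bullet\mathcal{Y}=0\}$ is the orthogonal subspace. The coherence is $\mu(\mathcal{S})=\frac{n_1}{n_2}\max_{j}\|\mathcal{P}\bullet\mathcal{E}_j\|_F^2$, where $\mathcal{E}_j\in\mathbb{R}^{n_1\times1\times n_3}$ has $\mathcal{E}_j(j,1,:)=\bm{e}$ and zeros elsewhere. Norms. $\|\cdot\|_F$ is the square root of the sum of squares of entries; $\|\mathcal{Y}\|_{\infty^*}=\max_i\|\mathcal{Y}(i,1,:)\|_2$. Tubal-sampling. The sampled indices are $\Omega(1),\dots,\Omega(m)\in\{1,\dots,n_1\}$. $\mathcal{T}_{\Omega}\in\mathbb{R}^{m\times1\times n_3}$ has $\mathcal{T}_{\Omega}(i,1,:)=\mathcal{T}(\Omega(i),1,:)$;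 $\mathcal{U}_{\Omega}\in\mathbb{R}^{m\times n_2\times n_3}$ has $\mathcal{U}_{\Omega}(i,:,:)=\mathcal{U}(\Omega(i),:,:)$; $\mathcal{P}_{\Omega}=\mathcal{U}_{\Omega}\bullet(\mathcal{U}_{\Omega}^{\dagger}\bullet\mathcal{U}_{\Omega})^{-1}\bullet\mathcal{U}_{\Omega}^{\dagger}$.
   Formalization: The formal theorem also assumes γ ≤ 1 (automatic if c ≤ 1; for c > 1 and γ > 1 the claim as stated can fail), and asserts the lower bound only for γ < 1, since β/(1−γ) is undefined at γ = 1. *)

theory Defs
  imports "HOL-Probability.Probability"
begin

text \<open>
  An \<open>n1 \<times> n2 \<times> n3\<close> tensor is an element \<open>A\<close> of \<open>real ^ 'n3 ^ 'n2 ^ 'n1\<close>, so \<open>A $ i $ j\<close> is the tube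
  \<open>A(i,j,:)\<close>; lateral slices and tubes regarded as tensors use the one-element index type \<open>1\<close>.
  The library's norm of such a nested vector is the square root of the sum of squares of all
  entries, i.e. the Frobenius norm.
\<close>

definition tube_inv_transform :: "real ^ 'n3 ^ 'n3 \<Rightarrow> real ^ 'n3 \<Rightarrow> real ^ 'n3" where
  "tube_inv_transform M a = matrix_inv M *v a"

definition tube_prod :: "real ^ 'n3 ^ 'n3 \<Rightarrow> real ^ 'n3 \<Rightarrow> real ^ 'n3 \<Rightarrow> real ^ 'n3" where
  "tube_prod M a b = tube_inv_transform M (\<chi> k. (M *v a) $ k * (M *v b) $ k)"

definition tensor_prod ::
  "real ^ 'n3 ^ 'n3 \<Rightarrow> real ^ 'n3 ^ 'n2 ^ 'n1 \<Rightarrow> real ^ 'n3 ^ 'n4 ^ 'n2 \<Rightarrow> real ^ 'n3 ^ 'n4 ^ 'n1" where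
  "tensor_prod M A B = (\<chi> i j. \<Sum>s\<in>UNIV. tube_prod M (A $ i $ s) (B $ s $ j))"

definition tensor_transform ::
  "real ^ 'n3 ^ 'n3 \<Rightarrow> real ^ 'n3 ^ 'n2 ^ 'n1 \<Rightarrow> real ^ 'n3 ^ 'n2 ^ 'n1" where
  "tensor_transform M A = (\<chi> i j. M *v (A $ i $ j))"

definition frontal_slice :: "real ^ 'n3 ^ 'n2 ^ 'n1 \<Rightarrow> 'n3 \<Rightarrow> real ^ 'n2 ^ 'n1" where
  "frontal_slice A k = (\<chi> i j. A $ i $ j $ k)"

text \<open>
  The transform is real, so the conjugate transpose of a slice is its transpose. The defining
  property of the tensor transpose is \<open>frontal_slice_tensor_transpose\<close> below.
\<close>

definition tensor_transpose ::
  "real ^ 'n3 ^ 'n3 \<Rightarrow> real ^ 'n3 ^ 'n2 ^ 'n1 \<Rightarrow> real ^ 'n3 ^ 'n1 ^ 'n2" where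
  "tensor_transpose M A = (\<chi> j i. tube_inv_transform M
     (\<chi> k. transpose (frontal_slice (tensor_transform M A) k) $ j $ i))"

lemma frontal_slice_tensor_transpose:
  assumes "invertible M"
  shows "frontal_slice (tensor_transform M (tensor_transpose M A)) k
    = transpose (frontal_slice (tensor_transform M A) k)"
proof -
  have "M ** matrix_inv M = mat 1"
    using assms unfolding invertible_def matrix_inv_def by (rule someI2_ex) simp
  then have "M *v (matrix_inv M *v a) = a" for a
    by (simp add: matrix_vector_mul_assoc)
  then show ?thesis
    by (simp add: frontal_slice_def tensor_transform_def tensor_transpose_def
        tube_inv_transform_def)
qed

definition unit_tube :: "real ^ 'n3 ^ 'n3 \<Rightarrow> real ^ 'n3" where
  "unit_tube M = tube_inv_transform M (\<chi> k. 1)"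

definition tensor_id :: "real ^ 'n3 ^ 'n3 \<Rightarrow> real ^ 'n3 ^ 'n ^ 'n" where
  "tensor_id M = (\<chi> i j. if i = j then unit_tube M else 0)"

definition is_tensor_inverse ::
  "real ^ 'n3 ^ 'n3 \<Rightarrow> real ^ 'n3 ^ 'n ^ 'n \<Rightarrow> real ^ 'n3 ^ 'n ^ 'n \<Rightarrow> bool" where
  "is_tensor_inverse M A B \<longleftrightarrow>
     tensor_prod M A B = tensor_id M \<and> tensor_prod M B A = tensor_id M"

definition tensor_invertible :: "real ^ 'n3 ^ 'n3 \<Rightarrow> real ^ 'n3 ^ 'n ^ 'n \<Rightarrow> bool" where
  "tensor_invertible M A \<longleftrightarrow> (\<exists>B. is_tensor_inverse M A B)"

text \<open>Only meaningful for arguments satisfying \<open>tensor_invertible\<close>; otherwise unspecified.\<close>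

definition tensor_inv :: "real ^ 'n3 ^ 'n3 \<Rightarrow> real ^ 'n3 ^ 'n ^ 'n \<Rightarrow> real ^ 'n3 ^ 'n ^ 'n" where
  "tensor_inv M A = (SOME B. is_tensor_inverse M A B)"

definition tensor_column :: "real ^ 'n3 ^ 'n2 ^ 'n1 \<Rightarrow> 'n2 \<Rightarrow> real ^ 'n3 ^ 1 ^ 'n1" where
  "tensor_column U j = (\<chi> i l. U $ i $ j)"

definition column_subspace ::
  "real ^ 'n3 ^ 'n3 \<Rightarrow> real ^ 'n3 ^ 'n2 ^ 'n1 \<Rightarrow> (real ^ 'n3 ^ 1 ^ 'n1) set" where
  "column_subspace M U =
     {\<Sum>j\<in>UNIV. tensor_prod M (tensor_column U j) (C j) | C :: 'n2 \<Rightarrow> real ^ 'n3 ^ 1 ^ 1. True}"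

definition orthogonal_subspace ::
  "real ^ 'n3 ^ 'n3 \<Rightarrow> real ^ 'n3 ^ 'n2 ^ 'n1 \<Rightarrow> (real ^ 'n3 ^ 1 ^ 'n1) set" where
  "orthogonal_subspace M U = {Y. tensor_prod M (tensor_transpose M U) Y = 0}"

definition projection ::
  "real ^ 'n3 ^ 'n3 \<Rightarrow> real ^ 'n3 ^ 'n2 ^ 'n1 \<Rightarrow> real ^ 'n3 ^ 'n1 ^ 'n1" where
  "projection M U = tensor_prod M
     (tensor_prod M U (tensor_inv M (tensor_prod M (tensor_transpose M U) U)))
     (tensor_transpose M U)"

definition unit_column :: "real ^ 'n3 ^ 'n3 \<Rightarrow> 'n1 \<Rightarrow> real ^ 'n3 ^ 1 ^ 'n1" where
  "unit_column M j = (\<chi> i l. if i = j then unit_tube M else 0)"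

definition coherence :: "real ^ 'n3 ^ 'n3 \<Rightarrow> real ^ 'n3 ^ 'n2 ^ 'n1 \<Rightarrow> real" where
  "coherence M (U :: real ^ 'n3 ^ 'n2 ^ 'n1) = real CARD('n1) / real CARD('n2) *
     (MAX j. (norm (tensor_prod M (projection M U) (unit_column M j)))\<^sup>2)"

definition max_tube_norm :: "real ^ 'n3 ^ 1 ^ 'n1 \<Rightarrow> real" where
  "max_tube_norm Y = (MAX i. norm (Y $ i $ 1))"

definition tubal_restrict ::
  "('m \<Rightarrow> 'n1) \<Rightarrow> real ^ 'n3 ^ 'n2 ^ 'n1 \<Rightarrow> real ^ 'n3 ^ 'n2 ^ 'm" where
  "tubal_restrict \<Omega> A = (\<chi> i. A $ \<Omega> i)"

text \<open>
  Independent uniform draws, one for each index of type \<open>'m\<close>. The default value of \<open>Pi_pmf\<close> is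
  irrelevant, as the product ranges over all of \<open>'m\<close>.
\<close>

definition tubal_sample :: "('m :: finite \<Rightarrow> 'n1 :: finite) pmf" where
  "tubal_sample = Pi_pmf UNIV undefined (\<lambda>_. pmf_of_set UNIV)"

end

theory Submission
  imports Defs
begin

text \<open>
  Since \<open>M\<close> is \<open>c\<close> times an orthogonal matrix, all quantities split over the frontal slices in the
  transform domain, where the tensor statements become least squares problems. If
  \<open>U\<^sub>\<Omega>\<^sup>T U\<^sub>\<Omega> \<ge> s > 0\<close> in every slice, the squared residual lies between
  \<open>|Y\<^sub>\<Omega>|\<^sup>2 - |U\<^sub>\<Omega>\<^sup>T Y\<^sub>\<Omega>|\<^sup>2 / s\<close> and \<open>|Y\<^sub>\<Omega>|\<^sup>2\<close>. The Gram matrices are controlled by the matrix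
  Chernoff bound, \<open>|Y\<^sub>\<Omega>|\<^sup>2\<close> by Bernstein's inequality in both directions, and \<open>U\<^sub>\<Omega>\<^sup>T Y\<^sub>\<Omega>\<close> by a
  Hilbert space Bernstein inequality; each of the four events fails with probability at most \<open>\<delta>\<close>.

  Two points need care. The vector inequality requires the tubes of \<open>Y\<close> to be not too
  concentrated, which is automatic when \<open>\<alpha> < 1\<close>, while the lower bound is trivial otherwise. The
  lower tail of \<open>|Y\<^sub>\<Omega>|\<^sup>2\<close> costs \<open>2/3 log (1/\<delta>)\<close> more than \<open>\<alpha>\<close> allows; this is absorbed by \<open>\<beta>\<close>,
  which the sharp form of the vector inequality leaves with enough slack.
\<close>

subsection \<open>Sums of independent uniform samples\<close>

text \<open>All tail bounds follow one scheme: a nonnegative functional of the partial sum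
  (\<open>trace\<close> of a matrix power, \<open>cosh\<close> of a norm, \<open>exp\<close>) grows
  in expectation by at most a fixed factor per draw. Matrices do not commute, so the factor for a
  new matrix summand can be split off only by a Golden-Thompson inequality. Powers
  \<open>(I - a S)^N\<close> with \<open>N\<close> a power of two stand in for the matrix
  exponential: Cauchy-Schwarz for traces and repeated squaring then replace spectral calculus.

  The scale linking the bounds is \<open>R = c^2 n2 \<mu> / n1\<close>. Orthonormality of
  \<open>U\<close> forces \<open>n1 R \<ge> n2 n3 \<ge> 1\<close>. Hence lowering \<beta> by
  \<open>2/3 l\<close> in the term \<open>n1 R \<beta> / (1 - \<gamma>)\<close> gains at least
  \<open>2/3 l\<close>, which is how \<beta> pays for the lower tail. Combined with \<gamma> \<le>
  1, the same inequality gives \<open>m \<ge> 8/3 l\<close>, which the vector inequality relies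
  on.\<close>

text \<open>Iterates a bound for a single draw, conditioned on the others. The additive
  \<open>\<epsilon>\<close> serves the trace bound, where commuting factors costs a small error per
  draw. The step is asked for proper subsets only, since the trace estimate must have room for one
  more summand.\<close>

lemma expectation_iid_sum_le:
  fixes p :: "'b::finite pmf" and w :: "'b \<Rightarrow> 'v::comm_monoid_add" and g :: "'v \<Rightarrow> real"
    and A :: "'i::finite set"
  assumes "0 \<le> \<rho>"
    and step: "\<And>B f. B \<subset> A \<Longrightarrow>
      measure_pmf.expectation p (\<lambda>y. g ((\<Sum>i\<in>B. w (f i)) + w y)) \<le> \<rho> * g (\<Sum>i\<in>B. w (f i)) + \<epsilon>"
  shows "measure_pmf.expectation (Pi_pmf A d (\<lambda>_. p)) (\<lambda>f. g (\<Sum>i\<in>A. w (f i)))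
    \<le> \<rho> ^ card A * g 0 + \<epsilon> * (\<Sum>j<card A. \<rho> ^ j)"
proof -
  have "finite A" by simp
  then show ?thesis using step
  proof (induction A)
    case empty
    then show ?case by simp
  next
    case (insert x A)
    let ?q = "Pi_pmf A d (\<lambda>_. p)"
    let ?S = "\<lambda>f :: 'i \<Rightarrow> 'b. \<Sum>i\<in>A. w (f i)"
    let ?P = "\<Sum>j<card A. \<rho> ^ j"
    have upd: "(\<Sum>i\<in>insert x A. w ((f(x := y)) i)) = ?S f + w y" for f y
    proof -
      have "(\<Sum>i\<in>A. w ((f(x := y)) i)) = ?S f"
        using insert by (intro sum.cong) auto
      then show ?thesis
        using insert by (simp add: add.commute)
    qed
    \<comment> \<open>Exchanging the two binds makes the draw for \<open>x\<close> the inner one, so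
      the one-draw bound applies for each fixed \<open>f\<close>.\<close>
    have "measure_pmf.expectation (Pi_pmf (insert x A) d (\<lambda>_. p)) (\<lambda>f. g (\<Sum>i\<in>insert x A. w (f i)))
      = measure_pmf.expectation (?q \<bind> (\<lambda>f. map_pmf (\<lambda>y. f(x := y)) p))
          (\<lambda>f. g (\<Sum>i\<in>insert x A. w (f i)))"
      using insert
      by (simp add: Pi_pmf_insert' map_pmf_def bind_commute_pmf[of p])
    also have "\<dots> = (\<Sum>f\<in>UNIV. pmf ?q f *\<^sub>R measure_pmf.expectation (map_pmf (\<lambda>y. f(x := y)) p)
          (\<lambda>f. g (\<Sum>i\<in>insert x A. w (f i))))"
      by (intro pmf_expectation_bind) auto
    also have "\<dots> = (\<Sum>f\<in>UNIV. pmf ?q f * measure_pmf.expectation p (\<lambda>y. g (?S f + w y)))"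
      by (simp only: integral_map_pmf upd real_scaleR_def)
    also have "\<dots> \<le> (\<Sum>f\<in>UNIV. pmf ?q f * (\<rho> * g (?S f) + \<epsilon>))"
      by (intro sum_mono mult_left_mono insert.prems) (use insert in auto)
    also have "\<dots> = measure_pmf.expectation ?q (\<lambda>f. \<rho> * g (?S f) + \<epsilon>)"
      by (subst integral_measure_pmf[of UNIV]) auto
    also have "\<dots> = \<rho> * measure_pmf.expectation ?q (\<lambda>f. g (?S f)) + \<epsilon>"
      by (simp add: integrable_measure_pmf_finite)
    also have "\<dots> \<le> \<rho> * (\<rho> ^ card A * g 0 + \<epsilon> * ?P) + \<epsilon>"
      using insert.IH insert.prems \<open>0 \<le> \<rho>\<close> by (intro add_right_mono mult_left_mono) blast+
    also have "\<dots> = \<rho> ^ card (insert x A) * g 0 + \<epsilon> * (\<Sum>j<card (insert x A). \<rho> ^ j)"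
      using insert(1,2)
      by (simp add: sum.lessThan_Suc_shift sum_distrib_left distrib_left mult_ac
          del: sum.lessThan_Suc)
    finally show ?case .
  qed
qed

lemma prob_le_expectation:
  fixes q :: "'a::finite pmf" and F :: "'a \<Rightarrow> real"
  assumes "\<And>x. 0 \<le> F x" "\<And>x. x \<in> E \<Longrightarrow> t \<le> F x" "0 < t"
  shows "measure_pmf.prob q E \<le> measure_pmf.expectation q F / t"
proof -
  have "t * measure_pmf.prob q E = measure_pmf.expectation q (\<lambda>x. t * indicator E x)"
    by simp
  also have "\<dots> \<le> measure_pmf.expectation q F"
    using assms by (intro integral_mono) (auto simp: integrable_measure_pmf_finite indicator_def)
  finally show ?thesis using \<open>0 < t\<close> by (simp add: field_simps)
qed

subsection \<open>A trace inequality of Golden-Thompson type\<close>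

primrec matpow :: "real ^ 'n ^ 'n \<Rightarrow> nat \<Rightarrow> real ^ 'n ^ 'n" where
  "matpow A 0 = mat 1"
| "matpow A (Suc n) = A ** matpow A n"

lemma matpow_add: "matpow A (m + n) = matpow A m ** matpow A n"
  by (induction m) (simp_all add: matrix_mul_assoc)

lemma matpow_mult: "matpow A (m * n) = matpow (matpow A m) n"
  by (induction n) (simp_all add: matpow_add)

lemma matpow_square: "matpow (A ** A) n = matpow A (2 * n)"
  using matpow_mult[of A 2 n] by (simp add: numeral_2_eq_2)

lemma matpow_double: "matpow A (2 * n) = matpow A n ** matpow A n"
  by (simp add: mult_2 matpow_add)

lemma matpow_commute: "A ** matpow A n = matpow A n ** A"
  using matpow_add[of A 1 n] matpow_add[of A n 1] by simp

lemma transpose_matpow: "transpose (matpow A n) = matpow (transpose A) n"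
  by (induction n) (simp_all add: matrix_transpose_mul matpow_commute)

lemma matpow_mat_1: "matpow (mat 1) n = mat 1"
  by (induction n) simp_all

lemma matpow_prod: "matpow (A ** B) (Suc n) = A ** matpow (B ** A) n ** B"
  by (induction n) (simp_all add: matrix_mul_assoc)

text \<open>\<open>(A B)^(k+1) = A (B A)^k B\<close>, and under the trace the leading
  \<open>A\<close> may move to the end.\<close>

lemma trace_matpow_prod:
  fixes A B :: "real ^ 'n ^ 'n"
  shows "trace (matpow (A ** B) n) = trace (matpow (B ** A) n)"
proof (cases n)
  case (Suc k)
  have "trace (matpow (A ** B) n) = trace (A ** (matpow (B ** A) k ** B))"
    by (simp add: Suc matpow_prod matrix_mul_assoc del: matpow.simps)
  also have "\<dots> = trace (matpow (B ** A) k ** (B ** A))"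
    by (subst trace_mul_sym) (simp only: matrix_mul_assoc)
  finally show ?thesis
    by (simp only: Suc matpow.simps matpow_commute)
qed simp

text \<open>Makes Cauchy-Schwarz for nested vectors available as Cauchy-Schwarz for traces.\<close>

lemma trace_transpose_mult: "trace (transpose A ** B) = A \<bullet> (B :: real ^ 'n ^ 'm)"
proof -
  have "trace (transpose A ** B) = (\<Sum>i\<in>UNIV. \<Sum>k\<in>UNIV. A $ k $ i * B $ k $ i)"
    by (simp add: trace_def matrix_matrix_mult_def transpose_def)
  also have "\<dots> = A \<bullet> B"
    by (subst sum.swap) (simp add: inner_vec_def)
  finally show ?thesis .
qed

lemma norm_transpose: "norm (transpose A) = norm (A :: real ^ 'n ^ 'm)"
  unfolding norm_eq_sqrt_inner using trace_mul_sym[of "transpose A" A]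
  by (metis trace_transpose_mult transpose_transpose)

lemma trace_mult_le: "trace (A ** B) \<le> norm A * norm (B :: real ^ 'n ^ 'm)"
  using norm_cauchy_schwarz[of "transpose A" B]
  by (simp add: trace_transpose_mult[symmetric] norm_transpose)

text \<open>
  The two inequalities are proved together: each doubling of the exponent in one of them uses
  the other. The second one is the Golden-Thompson inequality in its power form.
\<close>

lemma trace_matpow_power2:
  fixes X P Q :: "real ^ 'n ^ 'n"
  shows "\<bar>trace (matpow X (2 ^ Suc q))\<bar> \<le> trace (matpow (X ** transpose X) (2 ^ q))"
    and "transpose P = P \<Longrightarrow> transpose Q = Q \<Longrightarrow>
      trace (matpow (P ** Q) (2 ^ q)) \<le> trace (matpow P (2 ^ q) ** matpow Q (2 ^ q))"
proof (induction q arbitrary: X P Q)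
  case 0
  {
    case 1
    have "\<bar>trace (X ** X)\<bar> \<le> norm X * norm X"
      using Cauchy_Schwarz_ineq2[of "transpose X" X]
      by (simp add: trace_transpose_mult[symmetric] norm_transpose)
    also have "\<dots> = trace (X ** transpose X)"
      by (simp add: trace_mul_sym[of X] trace_transpose_mult power2_norm_eq_inner flip: power2_eq_square)
    finally show ?case by (simp add: numeral_2_eq_2)
  next
    case 2
    then show ?case by simp
  }
next
  case (Suc q)
  {
    case 1
    let ?A = "transpose X ** X" and ?B = "X ** transpose X"
    have sym: "transpose ?A = ?A" "transpose ?B = ?B"
      by (simp_all add: matrix_transpose_mul)
    have trB: "norm (matpow ?B (2 ^ q)) ^ 2 = trace (matpow ?B (2 ^ Suc q))"
      unfolding power2_norm_eq_inner trace_transpose_mult[symmetric] transpose_matpow sym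
      by (simp add: matpow_double)
    have trA: "norm (matpow ?A (2 ^ q)) ^ 2 = trace (matpow ?B (2 ^ Suc q))"
      unfolding power2_norm_eq_inner trace_transpose_mult[symmetric] transpose_matpow sym
        trace_matpow_prod[of X]
      by (simp add: matpow_double)
    then have eq: "norm (matpow ?A (2 ^ q)) = norm (matpow ?B (2 ^ q))"
      using trB by (metis norm_ge_zero power2_eq_imp_eq)
    have "\<bar>trace (matpow X (2 ^ Suc (Suc q)))\<bar> = \<bar>trace (matpow (X ** X) (2 ^ Suc q))\<bar>"
      by (simp only: matpow_square power_Suc)
    also have "\<dots> \<le> trace (matpow ((X ** X) ** transpose (X ** X)) (2 ^ q))"
      by (rule Suc.IH)
    also have "\<dots> = trace (matpow (X ** (?B ** transpose X)) (2 ^ q))"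
      by (simp only: matrix_transpose_mul matrix_mul_assoc)
    \<comment> \<open>A cyclic shift turns \<open>X X X^T X^T\<close> into
      \<open>(X X^T) (X^T X)\<close>, a product of symmetric matrices, so the second inequality
      applies. The powers of both factors have the same Frobenius norm, hence Cauchy-Schwarz ends in
      a single trace.\<close>
    also have "\<dots> = trace (matpow (?B ** ?A) (2 ^ q))"
      by (subst trace_matpow_prod) (simp only: matrix_mul_assoc)
    also have "\<dots> \<le> trace (matpow ?B (2 ^ q) ** matpow ?A (2 ^ q))"
      by (rule Suc.IH(2)[OF sym(2,1)])
    also have "\<dots> \<le> norm (matpow ?B (2 ^ q)) * norm (matpow ?A (2 ^ q))"
      by (rule trace_mult_le)
    also have "\<dots> = trace (matpow ?B (2 ^ Suc q))"
      by (simp only: eq trB flip: power2_eq_square)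
    finally show ?case .
  next
    case (2 P Q)
    have sym: "transpose (P ** P) = P ** P" "transpose (Q ** Q) = Q ** Q"
      using 2 by (simp_all add: matrix_transpose_mul)
    have "trace (matpow (P ** Q) (2 ^ Suc q)) \<le> \<bar>trace (matpow (P ** Q) (2 ^ Suc q))\<bar>"
      by simp
    \<comment> \<open>The first inequality with \<open>X = P Q\<close> produces
      \<open>P Q Q P\<close>, cyclically \<open>Q^2 P^2\<close>: again a product of symmetric
      matrices, with half the exponent.\<close>
    also have "\<dots> \<le> trace (matpow ((P ** Q) ** transpose (P ** Q)) (2 ^ q))"
      by (rule Suc.IH)
    also have "\<dots> = trace (matpow (P ** (Q ** Q ** P)) (2 ^ q))"
      by (simp only: matrix_transpose_mul 2 matrix_mul_assoc)
    also have "\<dots> = trace (matpow ((Q ** Q) ** (P ** P)) (2 ^ q))"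
      by (subst trace_matpow_prod) (simp only: matrix_mul_assoc)
    also have "\<dots> \<le> trace (matpow (Q ** Q) (2 ^ q) ** matpow (P ** P) (2 ^ q))"
      by (rule Suc.IH(2)[OF sym(2,1)])
    also have "\<dots> = trace (matpow P (2 ^ Suc q) ** matpow Q (2 ^ Suc q))"
      by (subst trace_mul_sym) (simp only: matpow_square power_Suc)
    finally show ?case .
  }
qed

subsection \<open>Rank-one sums and the matrix Chernoff bound\<close>

definition outer :: "real ^ 'n \<Rightarrow> real ^ 'n ^ 'n" where
  "outer u = (\<chi> i j. u $ i * u $ j)"

lemma outer_mult_vec: "outer u *v v = (u \<bullet> v) *\<^sub>R u"
  by (simp add: vec_eq_iff outer_def matrix_vector_mult_def inner_vec_def sum_distrib_right
      sum_distrib_left mult_ac)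

lemma transpose_outer: "transpose (outer u) = outer u"
  by (simp add: vec_eq_iff outer_def transpose_def mult.commute)

lemma trace_mult_outer: "trace (F ** outer u) = u \<bullet> (F *v u)"
proof -
  have "trace (F ** outer u) = (\<Sum>i\<in>UNIV. \<Sum>k\<in>UNIV. F $ i $ k * (u $ k * u $ i))"
    by (simp add: trace_def outer_def matrix_matrix_mult_def)
  also have "\<dots> = u \<bullet> (F *v u)"
    by (simp add: inner_vec_def matrix_vector_mult_def sum_distrib_left mult_ac)
  finally show ?thesis .
qed

lemma sum_matrix_vector_mult:
  fixes W :: "'a \<Rightarrow> real ^ 'n ^ 'm"
  shows "(\<Sum>i\<in>B. W i) *v v = (\<Sum>i\<in>B. W i *v v)"
  by (induction B rule: infinite_finite_induct) (simp_all add: matrix_vector_mult_add_rdistrib)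

lemma sum_matrix_mult_left:
  fixes W :: "'a \<Rightarrow> real ^ 'n ^ 'm"
  shows "F ** (\<Sum>i\<in>B. W i) = (\<Sum>i\<in>B. F ** W i)"
  by (induction B rule: infinite_finite_induct) (simp_all add: matrix_add_ldistrib)

lemma trace_sum: "trace (\<Sum>i\<in>B. W i :: real ^ 'n ^ 'n) = (\<Sum>i\<in>B. trace (W i))"
  by (induction B rule: infinite_finite_induct) (simp_all add: trace_add trace_0[unfolded mat_0])

lemma transpose_sum: "transpose (\<Sum>i\<in>B. W i :: real ^ 'n ^ 'm) = (\<Sum>i\<in>B. transpose (W i))"
  by (simp add: vec_eq_iff transpose_def)

lemma norm_matrix_vector_le: "norm (A *v v) \<le> norm A * norm (v :: real ^ 'n)"
proof -
  have "(norm (A *v v))\<^sup>2 = (\<Sum>i\<in>UNIV. (A $ i \<bullet> v)\<^sup>2)"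
    by (simp add: norm_vec_def L2_set_def sum_nonneg inner_vec_def matrix_vector_mult_def)
  also have "\<dots> \<le> (\<Sum>i\<in>UNIV. (norm (A $ i) * norm v)\<^sup>2)"
    by (intro sum_mono) (metis Cauchy_Schwarz_ineq2 abs_le_square_iff abs_norm_cancel
        abs_mult)
  also have "\<dots> = (norm A * norm v)\<^sup>2"
    by (simp add: power_mult_distrib sum_distrib_right[symmetric] norm_vec_def L2_set_def sum_nonneg)
  finally show ?thesis
    by (rule power2_le_imp_le) simp
qed

lemma symmetric_dot: "transpose A = A \<Longrightarrow> (A *v v) \<bullet> w = v \<bullet> (A *v (w :: real ^ 'n))"
  by (metis dot_lmul_matrix transpose_matrix_vector)

lemma norm_matpow_contraction:
  fixes P :: "real ^ 'n ^ 'n"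
  assumes "\<And>v. norm (P *v v) \<le> norm v"
  shows "norm (matpow P n *v v) \<le> norm v"
proof (induction n)
  case (Suc n)
  then show ?case
    using assms order_trans by (fastforce simp: matrix_vector_mul_assoc[symmetric])
qed simp

text \<open>Telescoping: \<open>P^(n+1) - Q^(n+1) = P (P^n - Q^n) + (P - Q) Q^n\<close>. Since both
  matrices are contractions, the errors of the factors merely add up.\<close>

lemma norm_matpow_diff_le:
  fixes P Q :: "real ^ 'n ^ 'n"
  assumes P: "\<And>v. norm (P *v v) \<le> norm v" and Q: "\<And>v. norm (Q *v v) \<le> norm v"
    and PQ: "\<And>v. norm (P *v v - Q *v v) \<le> K * norm v" and "0 \<le> K"
  shows "norm (matpow P n *v v - matpow Q n *v v) \<le> real n * K * norm v"
proof (induction n)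
  case (Suc n)
  let ?p = "matpow P n *v v" and ?q = "matpow Q n *v v"
  have "norm (P *v ?p - Q *v ?q) = norm (P *v (?p - ?q) + (P *v ?q - Q *v ?q))"
    by (simp add: matrix_vector_mult_diff_distrib)
  also have "\<dots> \<le> norm (?p - ?q) + K * norm ?q"
    by (intro norm_triangle_mono P PQ)
  also have "\<dots> \<le> real n * K * norm v + K * norm v"
    by (intro add_mono Suc.IH mult_left_mono norm_matpow_contraction Q \<open>0 \<le> K\<close>)
  finally show ?case
    by (simp add: matrix_vector_mul_assoc algebra_simps)
qed simp

lemma trace_diff_le:
  fixes A B :: "real ^ 'n ^ 'n"
  assumes "\<And>v. norm (A *v v - B *v v) \<le> K * norm v"
  shows "trace A \<le> trace B + real CARD('n) * K"
proof -
  have "A $ i $ i - B $ i $ i \<le> K" for i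
  proof -
    have "A $ i $ i - B $ i $ i = (A *v axis i 1 - B *v axis i 1) $ i"
      by (simp add: matrix_vector_mult_basis column_def)
    also have "\<dots> \<le> norm (A *v axis i 1 - B *v axis i 1)"
      using component_le_norm_cart abs_le_D1 by blast
    also have "\<dots> \<le> K"
      using assms[of "axis i 1"] by simp
    finally show ?thesis .
  qed
  then have "(\<Sum>i\<in>UNIV. A $ i $ i - B $ i $ i) \<le> (\<Sum>i\<in>(UNIV :: 'n set). K)"
    by (intro sum_mono)
  then show ?thesis
    by (simp add: trace_def sum_subtractf)
qed

text \<open>The reason for the exponents \<open>2 ^ Suc q\<close> below: even powers of a symmetric
  matrix have nonnegative traces and quadratic forms, whatever the signs of its eigenvalues.\<close>

lemma trace_matpow_even:
  fixes P :: "real ^ 'n ^ 'n"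
  assumes "transpose P = P"
  shows "trace (matpow P (2 * h)) = (norm (matpow P h))\<^sup>2"
  by (simp add: power2_norm_eq_inner trace_transpose_mult[symmetric] transpose_matpow assms
      matpow_double)

lemma dot_matpow_even:
  fixes P :: "real ^ 'n ^ 'n"
  assumes "transpose P = P"
  shows "v \<bullet> (matpow P (2 * h) *v v) = (norm (matpow P h *v v))\<^sup>2"
  using symmetric_dot[of "matpow P h" v "matpow P h *v v"]
  by (simp add: power2_norm_eq_inner transpose_matpow assms matpow_double matrix_vector_mul_assoc)

text \<open>Replaces "the largest eigenvalue is at most the trace". By Cauchy-Schwarz
  \<open>v . P^(2h) v = |P^h v|^2\<close> is at least the square of \<open>v . P^h v\<close>, which
  is iterated; the last squaring passes from \<open>|P^h v|\<close> to the Frobenius norm of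
  \<open>P^h\<close>, hence the exponent \<open>Suc q\<close>.\<close>

lemma dot_power_le_trace_matpow:
  fixes P :: "real ^ 'n ^ 'n"
  assumes sym: "transpose P = P" and "norm v = 1" and t: "0 \<le> t" "t \<le> v \<bullet> (P *v v)"
  shows "t ^ (2 ^ Suc q) \<le> trace (matpow P (2 ^ Suc q))"
proof -
  have sq: "x\<^sup>2 \<le> (norm (matpow P h *v v))\<^sup>2" if "0 \<le> x" "x \<le> v \<bullet> (matpow P h *v v)" for x h
  proof (rule power_mono[OF _ \<open>0 \<le> x\<close>])
    show "x \<le> norm (matpow P h *v v)"
      using norm_cauchy_schwarz[of v "matpow P h *v v"] that \<open>norm v = 1\<close> by simp
  qed
  have dot: "t ^ (2 ^ q) \<le> v \<bullet> (matpow P (2 ^ q) *v v)" for q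
  proof (induction q)
    case 0
    then show ?case using t by simp
  next
    case (Suc q)
    have "(t ^ 2 ^ q)\<^sup>2 \<le> (norm (matpow P (2 ^ q) *v v))\<^sup>2"
      using t by (intro sq Suc) simp
    then show ?case
      by (simp add: dot_matpow_even[OF sym] mult.commute flip: power_mult)
  qed
  have "(t ^ 2 ^ q)\<^sup>2 \<le> (norm (matpow P (2 ^ q) *v v))\<^sup>2"
    using t dot by (intro sq) simp_all
  also have "\<dots> \<le> (norm (matpow P (2 ^ q)))\<^sup>2"
    using norm_matrix_vector_le[of "matpow P (2 ^ q)" v] \<open>norm v = 1\<close>
    by (intro power_mono) simp_all
  finally show ?thesis
    by (simp add: trace_matpow_even[OF sym] mult.commute flip: power_mult)
qed

text \<open>The matrix acts as \<open>1 - a |u|^2\<close> along \<open>u\<close> and as the identity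
  across it. The geometric sum stands for \<open>(1 - (1 - a |u|^2)^n) / |u|^2\<close> and so covers
  \<open>u = 0\<close> without a division.\<close>

lemma matpow_rank_one_update:
  "matpow (mat 1 - a *\<^sub>R outer u) n =
    mat 1 - (a * (\<Sum>j<n. (1 - a * (norm u)\<^sup>2) ^ j)) *\<^sub>R outer u"
proof (induction n)
  case (Suc n)
  let ?k = "a * (\<Sum>j<n. (1 - a * (norm u)\<^sup>2) ^ j)" and ?r = "1 - a * (norm u)\<^sup>2"
  have k: "a * (\<Sum>j<Suc n. ?r ^ j) = a + ?r * ?k"
    by (simp add: sum.lessThan_Suc_shift sum_distrib_left distrib_left mult_ac
          del: sum.lessThan_Suc)
  show ?case
    unfolding matpow.simps Suc k
    by (simp add: matrix_eq matrix_vector_mul_assoc[symmetric] matrix_vector_mult_diff_rdistrib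
        matrix_vector_mult_diff_distrib scaleR_matrix_vector_assoc[symmetric] outer_mult_vec
        matrix_vector_mult_scaleR inner_diff_right power2_norm_eq_inner algebra_simps)
qed simp

context
  fixes z :: "'a \<Rightarrow> real ^ 'n" and B :: "'a set" and R :: real
  assumes z: "\<And>i. i \<in> B \<Longrightarrow> (norm (z i))\<^sup>2 \<le> R" and "0 \<le> R"
begin

lemma outer_sum_mult_vec: "(\<Sum>i\<in>B. outer (z i)) *v v = (\<Sum>i\<in>B. (z i \<bullet> v) *\<^sub>R z i)"
  by (simp add: sum_matrix_vector_mult outer_mult_vec)

lemma dot_outer_sum: "v \<bullet> ((\<Sum>i\<in>B. outer (z i)) *v v) = (\<Sum>i\<in>B. (z i \<bullet> v)\<^sup>2)"
  by (simp add: outer_sum_mult_vec inner_sum_right inner_commute power2_eq_square)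

lemma norm_outer_sum: "norm ((\<Sum>i\<in>B. outer (z i)) *v v) \<le> real (card B) * R * norm v"
proof -
  have "norm ((\<Sum>i\<in>B. outer (z i)) *v v) \<le> (\<Sum>i\<in>B. R * norm v)"
    unfolding outer_sum_mult_vec
  proof (intro sum_norm_le)
    fix i assume "i \<in> B"
    have "norm ((z i \<bullet> v) *\<^sub>R z i) \<le> (norm (z i) * norm v) * norm (z i)"
      by (simp add: mult_right_mono Cauchy_Schwarz_ineq2)
    also have "\<dots> \<le> R * norm v"
      using mult_right_mono[OF z[OF \<open>i \<in> B\<close>], of "norm v"]
      by (simp add: power2_eq_square mult_ac)
    finally show "norm ((z i \<bullet> v) *\<^sub>R z i) \<le> R * norm v" .
  qed
  then show ?thesis by simp
qed

text \<open>The operator inequality \<open>S^2 \<le> (card B * R) S\<close>, obtained from the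
  triangle inequality and Cauchy-Schwarz instead of eigenvalues.\<close>

lemma norm_outer_sum_square:
  "(norm ((\<Sum>i\<in>B. outer (z i)) *v v))\<^sup>2 \<le> real (card B) * R * (\<Sum>i\<in>B. (z i \<bullet> v)\<^sup>2)"
proof -
  have "norm (\<Sum>i\<in>B. (z i \<bullet> v) *\<^sub>R z i) \<le> (\<Sum>i\<in>B. norm (z i) * \<bar>z i \<bullet> v\<bar>)"
    by (intro sum_norm_le) (simp add: mult.commute)
  then have "(norm (\<Sum>i\<in>B. (z i \<bullet> v) *\<^sub>R z i))\<^sup>2 \<le> (\<Sum>i\<in>B. norm (z i) * \<bar>z i \<bullet> v\<bar>)\<^sup>2"
    by (intro power_mono) simp_all
  also have "\<dots> \<le> (\<Sum>i\<in>B. (norm (z i))\<^sup>2) * (\<Sum>i\<in>B. \<bar>z i \<bullet> v\<bar>\<^sup>2)"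
    by (rule Cauchy_Schwarz_ineq_sum)
  also have "\<dots> \<le> (real (card B) * R) * (\<Sum>i\<in>B. (z i \<bullet> v)\<^sup>2)"
    using sum_mono[of B "\<lambda>i. (norm (z i))\<^sup>2" "\<lambda>_. R"] z
    by (intro mult_mono) (simp_all add: sum_nonneg \<open>0 \<le> R\<close>)
  finally show ?thesis unfolding outer_sum_mult_vec .
qed

text \<open>In \<open>|v - a S v|^2 = |v|^2 - 2 a (v . S v) + a^2 |S v|^2\<close> the last term is
  at most \<open>2 a (v . S v)\<close> by \<open>norm_outer_sum_square\<close>.\<close>

lemma contraction_outer_sum:
  assumes "0 \<le> a" "a * real (card B) * R \<le> 2"
  shows "norm ((mat 1 - a *\<^sub>R (\<Sum>i\<in>B. outer (z i))) *v v) \<le> norm v"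
proof -
  let ?S = "\<Sum>i\<in>B. outer (z i)" and ?q = "\<Sum>i\<in>B. (z i \<bullet> v)\<^sup>2"
  have "a\<^sup>2 * (norm (?S *v v))\<^sup>2 \<le> a\<^sup>2 * (real (card B) * R * ?q)"
    by (intro mult_left_mono norm_outer_sum_square) simp
  also have "\<dots> = (a * real (card B) * R) * (a * ?q)"
    by (simp add: power2_eq_square)
  also have "\<dots> \<le> 2 * (a * ?q)"
    using assms by (intro mult_right_mono) (simp_all add: sum_nonneg)
  finally have "(norm (v - a *\<^sub>R (?S *v v)))\<^sup>2 \<le> (norm v)\<^sup>2"
    unfolding power2_norm_eq_inner using dot_outer_sum[of v]
    by (simp add: inner_diff_left inner_diff_right inner_commute power2_eq_square)
  then show ?thesis
    by (simp add: matrix_vector_mult_diff_rdistrib scaleR_matrix_vector_assoc power2_le_iff_abs_le)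
qed

end

lemma transpose_mat_diff:
  "transpose A = A \<Longrightarrow> transpose (mat 1 - a *\<^sub>R A) = mat 1 - a *\<^sub>R (A :: real ^ 'n ^ 'n)"
  by (simp add: vec_eq_iff transpose_def mat_def)

text \<open>\<open>I - a (S + u u^T)\<close> differs from \<open>(I - a S) (I - a u u^T)\<close> by
  \<open>a^2 S u u^T\<close>, of norm at most \<open>a^2 m R^2\<close>. Powers of contractions
  inherit this error \<open>N\<close>-fold, the Golden-Thompson inequality separates the two
  factors, and the power of the rank-one factor is explicit.\<close>

lemma trace_matpow_step:
  fixes u :: "'b::finite \<Rightarrow> real ^ 'n" and z :: "'i \<Rightarrow> real ^ 'n"
  assumes iso: "(\<Sum>j\<in>UNIV. outer (u j)) = mat 1"
    and u: "\<And>j. (norm (u j))\<^sup>2 \<le> R" and z: "\<And>i. i \<in> B \<Longrightarrow> (norm (z i))\<^sup>2 \<le> R"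
    and "0 < R" and B: "card B < m" "finite B" and a: "0 \<le> a" "a * real m * R \<le> 1"
  defines "S \<equiv> \<Sum>i\<in>B. outer (z i)"
  shows "(\<Sum>j\<in>UNIV. trace (matpow (mat 1 - a *\<^sub>R (S + outer (u j))) (2 ^ Suc q))) / real CARD('b)
    \<le> exp (- ((1 - (1 - a * R) ^ 2 ^ Suc q) / (R * real CARD('b)))) *
        trace (matpow (mat 1 - a *\<^sub>R S) (2 ^ Suc q))
      + real CARD('n) * (2 ^ Suc q * (a\<^sup>2 * real m * R\<^sup>2))"
proof -
  let ?N = "2 ^ Suc q :: nat" and ?n1 = "real CARD('b)"
  let ?P = "mat 1 - a *\<^sub>R S"
  let ?F = "matpow ?P ?N"
  let ?K = "a\<^sup>2 * real m * R\<^sup>2"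
  let ?k = "\<lambda>x. a * (\<Sum>j<?N. (1 - a * x) ^ j)"
  have symS: "transpose S = S"
    by (simp add: S_def transpose_sum transpose_outer)
  have symP: "transpose ?P = ?P"
    by (rule transpose_mat_diff[OF symS])
  have "a * R \<le> a * real m * R"
    using B a \<open>0 < R\<close> mult_left_mono[of 1 "real m" a] by (intro mult_right_mono) auto
  then have aR: "a * R \<le> 1" using a by linarith
  have cS: "norm (?P *v v) \<le> norm v" for v
  proof -
    have "a * real (card B) * R \<le> a * real m * R"
      using B a \<open>0 < R\<close> by (intro mult_right_mono mult_left_mono) simp_all
    then have "a * real (card B) * R \<le> 2" using a by linarith
    then show ?thesis
      unfolding S_def using contraction_outer_sum[of B z R a v] z a \<open>0 < R\<close> by simp
  qed
  have Fnonneg: "0 \<le> v \<bullet> (?F *v v)" for v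
    by (simp only: power_Suc dot_matpow_even[OF symP]) simp
  have one: "trace (matpow (mat 1 - a *\<^sub>R (S + outer (u j))) ?N)
      \<le> trace ?F - ?k R * (u j \<bullet> (?F *v u j)) + real CARD('n) * (real ?N * ?K)" for j
  proof -
    let ?Q = "mat 1 - a *\<^sub>R outer (u j)" and ?Z = "mat 1 - a *\<^sub>R (S + outer (u j))"
    have cQ: "norm (?Q *v v) \<le> norm v" for v
      using contraction_outer_sum[of "{j}" u R a v] u[of j] a \<open>0 < R\<close> aR by simp
    have cPQ: "norm ((?P ** ?Q) *v v) \<le> norm v" for v
      using cS[of "?Q *v v"] cQ[of v] by (simp add: matrix_vector_mul_assoc)
    have cZ: "norm (?Z *v v) \<le> norm v" for v
    proof -
      \<comment> \<open>The fresh index \<open>None\<close> adds \<open>u j\<close> to the family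
        even if that vector already occurs in it; \<open>card B < m\<close> keeps the enlarged
        family within \<open>m\<close> members.\<close>
      define z' where "z' = (\<lambda>x. case x of None \<Rightarrow> u j | Some i \<Rightarrow> z i)"
      let ?B = "insert None (Some ` B)"
      have "(\<Sum>x\<in>?B. outer (z' x)) = S + outer (u j)"
        using B by (simp add: S_def z'_def sum.reindex add.commute)
      moreover have "a * real (card ?B) * R \<le> 2"
      proof -
        have "a * real (card ?B) * R \<le> a * real m * R"
          using B a \<open>0 < R\<close>
          by (intro mult_right_mono mult_left_mono) (simp_all add: card_image)
        then show ?thesis using a by linarith
      qed
      moreover have "(norm (z' x))\<^sup>2 \<le> R" if "x \<in> ?B" for x
        using that u z by (auto simp: z'_def)
      ultimately show ?thesis
        using contraction_outer_sum[of ?B z' R a v] a \<open>0 < R\<close> by simp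
    qed
    have diff: "norm (?Z *v v - (?P ** ?Q) *v v) \<le> ?K * norm v" for v
    proof -
      have "?Z *v v - (?P ** ?Q) *v v = - (a\<^sup>2 *\<^sub>R (S *v (outer (u j) *v v)))"
        by (simp add: matrix_vector_mul_assoc[symmetric] matrix_vector_mult_diff_rdistrib
            matrix_vector_mult_add_rdistrib matrix_vector_mult_diff_distrib
            scaleR_matrix_vector_assoc[symmetric] matrix_vector_mult_scaleR power2_eq_square
            algebra_simps)
      then have "norm (?Z *v v - (?P ** ?Q) *v v) = a\<^sup>2 * norm (S *v (outer (u j) *v v))"
        by simp
      also have "\<dots> \<le> a\<^sup>2 * (real (card B) * R * norm (outer (u j) *v v))"
        unfolding S_def using z \<open>0 < R\<close> by (intro mult_left_mono norm_outer_sum) auto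
      also have "\<dots> \<le> a\<^sup>2 * (real m * R * (R * norm v))"
        using norm_outer_sum[of "{j}" u R v] u[of j] B \<open>0 < R\<close>
        by (intro mult_left_mono mult_mono) simp_all
      finally show ?thesis by (simp add: power2_eq_square mult_ac)
    qed
    have "trace (matpow ?Z ?N) \<le> trace (matpow (?P ** ?Q) ?N) + real CARD('n) * (real ?N * ?K)"
      by (intro trace_diff_le norm_matpow_diff_le cZ cPQ diff) simp
    also have "trace (matpow (?P ** ?Q) ?N) \<le> trace (?F ** matpow ?Q ?N)"
      by (intro trace_matpow_power2(2) symP transpose_mat_diff transpose_outer)
    also have "\<dots> = trace ?F - ?k ((norm (u j))\<^sup>2) * (u j \<bullet> (?F *v u j))"
    proof -
      have "?F ** matpow ?Q ?N = ?F - ?k ((norm (u j))\<^sup>2) *\<^sub>R (?F ** outer (u j))"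
        unfolding matpow_rank_one_update
        by (simp add: matrix_eq matrix_vector_mul_assoc[symmetric]
            matrix_vector_mult_diff_rdistrib matrix_vector_mult_diff_distrib
            scaleR_matrix_vector_assoc[symmetric] matrix_vector_mult_scaleR)
      moreover have "trace (c *\<^sub>R (?F ** outer (u j))) = c * trace (?F ** outer (u j))" for c
        by (simp add: trace_def sum_distrib_left)
      ultimately show ?thesis
        by (simp add: trace_sub trace_mult_outer)
    qed
    \<comment> \<open>\<open>?k\<close> decreases in its argument, so the individual squared length
      may be replaced by the uniform bound \<open>R\<close>.\<close>
    also have "\<dots> \<le> trace ?F - ?k R * (u j \<bullet> (?F *v u j))"
    proof -
      have "?k R \<le> ?k ((norm (u j))\<^sup>2)"
        using u[of j] a aR by (intro mult_left_mono sum_mono power_mono) (auto intro: mult_left_mono)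
      then show ?thesis
        using mult_right_mono Fnonneg by (intro diff_left_mono) blast
    qed
    finally show ?thesis by simp
  qed
  \<comment> \<open>Isotropy closes the recursion: the quadratic forms add up to the very trace
    being tracked.\<close>
  have "(\<Sum>j\<in>UNIV. u j \<bullet> (?F *v u j)) = trace ?F"
    by (simp only: trace_mult_outer[symmetric] trace_sum[symmetric] sum_matrix_mult_left[symmetric]
        iso matrix_mul_rid)
  moreover have "(\<Sum>j\<in>UNIV. trace (matpow (mat 1 - a *\<^sub>R (S + outer (u j))) ?N))
      \<le> (\<Sum>j\<in>UNIV. trace ?F - ?k R * (u j \<bullet> (?F *v u j)) + real CARD('n) * (real ?N * ?K))"
    by (intro sum_mono one)
  ultimately have "(\<Sum>j\<in>UNIV. trace (matpow (mat 1 - a *\<^sub>R (S + outer (u j))) ?N))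
      \<le> ?n1 * trace ?F - ?k R * trace ?F + ?n1 * (real CARD('n) * (real ?N * ?K))"
    by (simp add: sum.distrib sum_subtractf sum_distrib_left[symmetric])
  then have "(\<Sum>j\<in>UNIV. trace (matpow (mat 1 - a *\<^sub>R (S + outer (u j))) ?N)) / ?n1
      \<le> (1 - ?k R / ?n1) * trace ?F + real CARD('n) * (real ?N * ?K)"
    by (simp add: field_simps)
  moreover have "?k R = (1 - (1 - a * R) ^ ?N) / R"
  proof -
    have "1 - (1 - a * R) ^ ?N = a * R * (\<Sum>j<?N. (1 - a * R) ^ j)"
      using one_diff_power_eq[of "1 - a * R" ?N] by simp
    then show ?thesis using \<open>0 < R\<close> by simp
  qed
  moreover have "(1 - ?k R / ?n1) * trace ?F \<le> exp (- (?k R / ?n1)) * trace ?F"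
  proof (rule mult_right_mono)
    show "1 - ?k R / ?n1 \<le> exp (- (?k R / ?n1))"
      using exp_ge_add_one_self[of "- (?k R / ?n1)"] by simp
    show "0 \<le> trace ?F"
      by (simp only: power_Suc trace_matpow_even[OF symP]) simp
  qed
  ultimately show ?thesis by simp
qed

lemma one_minus_exp_ge:
  fixes x :: real
  assumes "0 \<le> x"
  shows "x - x\<^sup>2 / 2 \<le> 1 - exp (- x)"
proof -
  have "\<exists>t. exp (- x) = (\<Sum>m<3. (- x) ^ m / fact m) + exp t / fact 3 * (- x) ^ 3"
    using Maclaurin_exp_le[of "- x" 3] by blast
  then obtain t where "exp (- x) = (\<Sum>m<3. (- x) ^ m / fact m) + exp t / fact 3 * (- x) ^ 3"
    by blast
  moreover have "exp t / fact 3 * (- x) ^ 3 \<le> 0"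
    using assms by (simp add: mult_nonneg_nonpos power3_eq_cube)
  ultimately show ?thesis
    by (simp add: numeral_3_eq_3 power2_eq_square)
qed

text \<open>
  The matrix Chernoff lower tail for rank-one summands. The exponential of the classical proof
  is replaced by \<open>(1 - a S) ^ N\<close> with \<open>a = \<gamma> / (R N)\<close> and \<open>N = 2 ^ q\<close>; the error made in
  commuting factors vanishes as \<open>N\<close> grows.
\<close>

lemma prob_frame_lower_bound_le:
  fixes u :: "'b::finite \<Rightarrow> real ^ 'n"
  assumes iso: "(\<Sum>j\<in>UNIV. outer (u j)) = mat 1"
    and u: "\<And>j. (norm (u j))\<^sup>2 \<le> R" and "0 < R" and \<gamma>: "0 \<le> \<gamma>" "\<gamma> \<le> 1"
  shows "measure_pmf.prob (Pi_pmf (UNIV :: 'i::finite set) d (\<lambda>_. pmf_of_set UNIV))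
      {f. \<exists>v. v \<noteq> 0 \<and> (\<Sum>i\<in>UNIV. (u (f i) \<bullet> v)\<^sup>2)
            \<le> (1 - \<gamma>) * (real CARD('i) / real CARD('b)) * (norm v)\<^sup>2}
    \<le> real CARD('n) * exp (- (\<gamma>\<^sup>2 * real CARD('i) / (2 * real CARD('b) * R)))"
    (is "measure_pmf.prob ?q ?E \<le> _")
proof -
  let ?m = "real CARD('i)" and ?n1 = "real CARD('b)" and ?n = "real CARD('n)"
  define s where "s = (1 - \<gamma>) * (?m / ?n1)"
  \<comment> \<open>The optimal value \<open>- ln (1 - \<gamma>) / R\<close> is infinite at
    \<open>\<gamma> = 1\<close>; the simpler choice covers that case and still yields the exponent
    \<open>\<gamma>^2 / 2\<close>.\<close>
  define \<theta> where "\<theta> = \<gamma> / R"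
  define \<rho> where "\<rho> = exp (- ((1 - exp (- \<gamma>)) / (R * ?n1)))"
  let ?N = "\<lambda>q. 2 ^ Suc q :: nat"
  let ?a = "\<lambda>q. \<theta> / ?N q"
  let ?g = "\<lambda>q (A :: real ^ 'n ^ 'n). trace (matpow (mat 1 - ?a q *\<^sub>R A) (?N q))"
  let ?err = "\<lambda>q. ?n * (?N q * ((?a q)\<^sup>2 * ?m * R\<^sup>2))"
  have \<theta>: "0 \<le> \<theta>" and s0: "0 \<le> s"
    using \<gamma> \<open>0 < R\<close> by (simp_all add: \<theta>_def s_def)
  have \<rho>: "0 < \<rho>" "\<rho> \<le> 1"
    using \<gamma> \<open>0 < R\<close> by (simp_all add: \<rho>_def)
  have bound: "measure_pmf.prob ?q ?E * (1 - ?a q * s) ^ ?N q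
      \<le> \<rho> ^ CARD('i) * ?n + ?err q * ?m"
    if small: "?a q * ?m * R \<le> 1" "?a q * s < 1" for q
  proof -
    have a0: "0 \<le> ?a q" using \<theta> by simp
    have "1 * ?m \<ge> 1" using zero_less_card_finite[where 'a='i] by simp
    then have "?a q * R * 1 \<le> ?a q * R * ?m"
      using a0 \<open>0 < R\<close> by (intro mult_left_mono mult_nonneg_nonneg) auto
    moreover have "?a q * R * ?m = ?a q * ?m * R" by (simp only: mult_ac)
    ultimately have aR: "?a q * R \<le> 1" using small by linarith
    \<comment> \<open>\<open>(1 - a R)^N \<le> exp (- a R N) = exp (- \<gamma>)\<close> gives a
      growth factor independent of \<open>q\<close>.\<close>
    have \<rho>ge: "exp (- ((1 - (1 - ?a q * R) ^ ?N q) / (R * ?n1))) \<le> \<rho>"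
    proof -
      have "(1 - ?a q * R) ^ ?N q \<le> exp (- (?a q * R)) ^ ?N q"
        using aR exp_ge_add_one_self[of "- (?a q * R)"] by (intro power_mono) simp_all
      also have "\<dots> = exp (- \<gamma>)"
        using \<open>0 < R\<close> unfolding exp_of_nat_mult[symmetric] by (simp add: \<theta>_def)
      finally show ?thesis
        using \<open>0 < R\<close> by (simp add: \<rho>_def divide_right_mono)
    qed
    have nn: "0 \<le> ?g q (\<Sum>i\<in>B. outer (u (f i)))" for B :: "'i set" and f
      by (simp only: power_Suc trace_matpow_even transpose_mat_diff transpose_sum transpose_outer)
        simp
    have "measure_pmf.expectation ?q (\<lambda>f. ?g q (\<Sum>i\<in>UNIV. outer (u (f i))))
      \<le> \<rho> ^ card (UNIV :: 'i set) * ?g q 0 + ?err q * (\<Sum>j<card (UNIV :: 'i set). \<rho> ^ j)"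
    proof (rule expectation_iid_sum_le[where g = "?g q" and w = "\<lambda>y. outer (u y)"])
      fix B :: "'i set" and f assume "B \<subset> UNIV"
      then have "card B < CARD('i)" by (intro psubset_card_mono) auto
      then have "measure_pmf.expectation (pmf_of_set UNIV)
          (\<lambda>y. ?g q ((\<Sum>i\<in>B. outer (u (f i))) + outer (u y)))
        \<le> exp (- ((1 - (1 - ?a q * R) ^ ?N q) / (R * ?n1))) * ?g q (\<Sum>i\<in>B. outer (u (f i)))
          + ?err q"
        using trace_matpow_step[OF iso u, of B "\<lambda>i. u (f i)" "CARD('i)" "?a q" q] u \<open>0 < R\<close> a0 small
        by (simp add: integral_pmf_of_set del: power_Suc)
      also have "\<dots> \<le> \<rho> * ?g q (\<Sum>i\<in>B. outer (u (f i))) + ?err q"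
        by (intro add_right_mono mult_right_mono \<rho>ge nn)
      finally show "measure_pmf.expectation (pmf_of_set UNIV)
          (\<lambda>y. ?g q ((\<Sum>i\<in>B. outer (u (f i))) + outer (u y)))
        \<le> \<rho> * ?g q (\<Sum>i\<in>B. outer (u (f i))) + ?err q" .
    qed (use \<rho> in simp)
    also have "\<dots> \<le> \<rho> ^ CARD('i) * ?n + ?err q * ?m"
    proof (intro add_mono mult_left_mono)
      have "(\<Sum>j<CARD('i). \<rho> ^ j) \<le> (\<Sum>j<CARD('i). 1)"
        using \<rho> by (intro sum_mono power_le_one) auto
      then show "(\<Sum>j<CARD('i). \<rho> ^ j) \<le> ?m" by simp
      show "?g q 0 \<le> ?n" by (simp add: matpow_mat_1 trace_I del: power_Suc)
    qed (use \<rho> \<open>0 < R\<close> in auto)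
    finally have E: "measure_pmf.expectation ?q (\<lambda>f. ?g q (\<Sum>i\<in>UNIV. outer (u (f i))))
      \<le> \<rho> ^ CARD('i) * ?n + ?err q * ?m" .
    have t: "0 < (1 - ?a q * s) ^ ?N q" using small by simp
    have "measure_pmf.prob ?q ?E
      \<le> measure_pmf.expectation ?q (\<lambda>f. ?g q (\<Sum>i\<in>UNIV. outer (u (f i)))) / (1 - ?a q * s) ^ ?N q"
    proof (intro prob_le_expectation nn t)
      fix f assume "f \<in> ?E"
      then obtain v where v: "v \<noteq> 0" "(\<Sum>i\<in>UNIV. (u (f i) \<bullet> v)\<^sup>2) \<le> s * (norm v)\<^sup>2"
        by (auto simp: s_def)
      define w where "w = v /\<^sub>R norm v"
      have "norm w = 1" using v by (simp add: w_def)
      have "(\<Sum>i\<in>UNIV. (u (f i) \<bullet> w)\<^sup>2) = (\<Sum>i\<in>UNIV. (u (f i) \<bullet> v)\<^sup>2) / (norm v)\<^sup>2"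
        by (simp add: w_def power_mult_distrib power_divide sum_divide_distrib field_simps)
      also have "\<dots> \<le> s" using v by (simp add: field_simps)
      finally have "?a q * (\<Sum>i\<in>UNIV. (u (f i) \<bullet> w)\<^sup>2) \<le> ?a q * s"
        by (intro mult_left_mono a0)
      moreover have "w \<bullet> ((mat 1 - ?a q *\<^sub>R (\<Sum>i\<in>UNIV. outer (u (f i)))) *v w)
          = 1 - ?a q * (\<Sum>i\<in>UNIV. (u (f i) \<bullet> w)\<^sup>2)"
        using dot_outer_sum[of UNIV "\<lambda>i. u (f i)" R w] u \<open>0 < R\<close> \<open>norm w = 1\<close>
        by (simp add: matrix_vector_mult_diff_rdistrib scaleR_matrix_vector_assoc[symmetric]
            inner_diff_right norm_eq_1)
      ultimately have "1 - ?a q * s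
          \<le> w \<bullet> ((mat 1 - ?a q *\<^sub>R (\<Sum>i\<in>UNIV. outer (u (f i)))) *v w)"
        by linarith
      then show "(1 - ?a q * s) ^ ?N q \<le> ?g q (\<Sum>i\<in>UNIV. outer (u (f i)))"
        using \<open>norm w = 1\<close> small
        by (intro dot_power_le_trace_matpow transpose_mat_diff)
          (simp_all add: transpose_sum transpose_outer)
    qed
    then have "measure_pmf.prob ?q ?E * (1 - ?a q * s) ^ ?N q
      \<le> measure_pmf.expectation ?q (\<lambda>f. ?g q (\<Sum>i\<in>UNIV. outer (u (f i))))"
      using t by (simp add: pos_le_divide_eq)
    with E show ?thesis by linarith
  qed
  \<comment> \<open>Now \<open>q\<close> tends to infinity: \<open>(1 - a s)^N\<close> tends to
    \<open>exp (- \<theta> s)\<close>, and the error vanishes because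
    \<open>N a^2 = \<theta>^2 / N\<close>.\<close>
  have N: "filterlim ?N at_top sequentially"
    by (intro filterlim_subseq strict_monoI_Suc) simp
  have inv: "(\<lambda>q. c / real (?N q)) \<longlonglongrightarrow> 0" for c :: real
    by (intro tendsto_divide_0[OF tendsto_const] filterlim_at_top_imp_at_infinity
        filterlim_compose[OF filterlim_real_sequentially] N)
  have "(\<lambda>q. measure_pmf.prob ?q ?E * (1 - ?a q * s) ^ ?N q)
      \<longlonglongrightarrow> measure_pmf.prob ?q ?E * exp (- (\<theta> * s))"
  proof (intro tendsto_mult tendsto_const)
    show "(\<lambda>q. (1 - ?a q * s) ^ ?N q) \<longlonglongrightarrow> exp (- (\<theta> * s))"
      using filterlim_compose[OF tendsto_exp_limit_sequentially[of "- (\<theta> * s)"] N] by simp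
  qed
  moreover have "(\<lambda>q. \<rho> ^ CARD('i) * ?n + ?err q * ?m) \<longlonglongrightarrow> \<rho> ^ CARD('i) * ?n + 0"
  proof (intro tendsto_add tendsto_const)
    have "?err q * ?m = (?n * \<theta>\<^sup>2 * ?m * R\<^sup>2 * ?m) / ?N q" for q
      by (simp add: power2_eq_square)
    then show "(\<lambda>q. ?err q * ?m) \<longlonglongrightarrow> 0"
      using inv[of "?n * \<theta>\<^sup>2 * ?m * R\<^sup>2 * ?m"] by simp
  qed
  moreover have "\<forall>\<^sub>F q in sequentially. measure_pmf.prob ?q ?E * (1 - ?a q * s) ^ ?N q
      \<le> \<rho> ^ CARD('i) * ?n + ?err q * ?m"
  proof -
    have "\<forall>\<^sub>F q in sequentially. \<theta> * ?m * R / ?N q < 1" "\<forall>\<^sub>F q in sequentially. \<theta> * s / ?N q < 1"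
      by (rule order_tendstoD(2)[OF inv zero_less_one])+
    then show ?thesis
      by eventually_elim (rule bound, simp_all)
  qed
  ultimately have "measure_pmf.prob ?q ?E * exp (- (\<theta> * s)) \<le> \<rho> ^ CARD('i) * ?n"
    using tendsto_le[OF sequentially_bot] by fastforce
  then have "measure_pmf.prob ?q ?E \<le> ?n * (\<rho> ^ CARD('i) * exp (\<theta> * s))"
    by (simp add: exp_minus field_simps)
  also have "\<rho> ^ CARD('i) * exp (\<theta> * s)
      = exp (- (?m / (R * ?n1) * (1 - exp (- \<gamma>) - \<gamma> * (1 - \<gamma>))))"
    unfolding \<rho>_def exp_of_nat_mult[symmetric] exp_add[symmetric]
    by (simp add: \<theta>_def s_def algebra_simps diff_divide_distrib add_divide_distrib)
  also have "\<dots> \<le> exp (- (?m / (R * ?n1) * (\<gamma>\<^sup>2 / 2)))"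
  proof -
    have "\<gamma>\<^sup>2 / 2 \<le> 1 - exp (- \<gamma>) - \<gamma> * (1 - \<gamma>)"
      using one_minus_exp_ge[OF \<open>0 \<le> \<gamma>\<close>] by (simp add: power2_eq_square algebra_simps)
    then have "?m / (R * ?n1) * (\<gamma>\<^sup>2 / 2) \<le> ?m / (R * ?n1) * (1 - exp (- \<gamma>) - \<gamma> * (1 - \<gamma>))"
      using \<open>0 < R\<close> by (intro mult_left_mono) simp_all
    then show ?thesis by simp
  qed
  finally show ?thesis
    by (simp add: mult_ac)
qed

subsection \<open>Scalar and vector Bernstein inequalities\<close>

text \<open>Jensen for powers. The induction step rests on \<open>a - b\<close> and
  \<open>a^k - b^k\<close> having the same sign.\<close>

lemma power_convex_combination:
  fixes a b p :: real
  assumes "0 \<le> p" "p \<le> 1" "0 \<le> a" "0 \<le> b"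
  shows "((1 - p) * a + p * b) ^ k \<le> (1 - p) * a ^ k + p * b ^ k"
proof (induction k)
  case (Suc k)
  have "0 \<le> (a - b) * (a ^ k - b ^ k)"
  proof (cases "a \<le> b")
    case True
    then show ?thesis
      using assms power_mono[of a b k] by (intro mult_nonpos_nonpos) auto
  next
    case False
    then show ?thesis
      using assms power_mono[of b a k] by (intro mult_nonneg_nonneg) auto
  qed
  then have "0 \<le> p * (1 - p) * ((a - b) * (a ^ k - b ^ k))"
    using assms by (intro mult_nonneg_nonneg[OF mult_nonneg_nonneg]) auto
  moreover have "((1 - p) * a + p * b) * ((1 - p) * a + p * b) ^ k
      \<le> ((1 - p) * a + p * b) * ((1 - p) * a ^ k + p * b ^ k)"
    using assms by (intro mult_left_mono Suc add_nonneg_nonneg mult_nonneg_nonneg) auto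
  ultimately show ?case
    by (simp add: algebra_simps)
qed simp

text \<open>\<open>cosh (sqrt t)\<close> is a power series in \<open>t\<close> with nonnegative
  coefficients, hence convex for \<open>t \<ge> 0\<close> term by term.\<close>

lemma cosh_convex_square:
  fixes p r x y :: real
  assumes p: "0 \<le> p" "p \<le> 1" and r: "r\<^sup>2 = (1 - p) * x\<^sup>2 + p * y\<^sup>2"
  shows "cosh r \<le> (1 - p) * cosh x + p * cosh y"
proof (rule sums_le)
  show "(\<lambda>n. if even n then r ^ n /\<^sub>R fact n else 0) sums cosh r"
    by (rule cosh_converges)
  show "(\<lambda>n. (1 - p) * (if even n then x ^ n /\<^sub>R fact n else 0)
      + p * (if even n then y ^ n /\<^sub>R fact n else 0)) sums ((1 - p) * cosh x + p * cosh y)"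
    by (intro sums_add sums_mult cosh_converges)
  show "(if even n then r ^ n /\<^sub>R fact n else 0) \<le> (1 - p) * (if even n then x ^ n /\<^sub>R fact n else 0)
      + p * (if even n then y ^ n /\<^sub>R fact n else 0)" for n
  proof (cases "even n")
    case True
    then obtain k where n: "n = 2 * k" by blast
    have "r ^ n \<le> (1 - p) * x ^ n + p * y ^ n"
      using power_convex_combination[OF p, of "x\<^sup>2" "y\<^sup>2" k] by (simp add: n r power_mult)
    then show ?thesis
      using True by (simp add: field_simps)
  qed simp
qed

lemma sinh_ge_self: "0 \<le> x \<Longrightarrow> x \<le> sinh (x :: real)"
proof -
  assume "0 \<le> x"
  have "(\<lambda>x. sinh x - x) 0 \<le> (\<lambda>x. sinh x - x) x"
  proof (rule DERIV_nonneg_imp_nondecreasing[OF \<open>0 \<le> x\<close>])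
    fix t :: real
    show "\<exists>y. ((\<lambda>x. sinh x - x) has_real_derivative y) (at t) \<and> 0 \<le> y"
      by (intro exI[of _ "cosh t - 1"]) (auto intro!: derivative_eq_intros simp: cosh_real_ge_1)
  qed
  then show ?thesis by simp
qed

text \<open>
  For fixed norms \<open>cosh (norm (w + x))\<close> is convex in \<open>w \<bullet> x\<close>, hence below the chord through the
  parallel and antiparallel cases.
\<close>

lemma cosh_norm_add_le:
  fixes w x :: "'a::real_inner"
  shows "cosh (norm (w + x))
    \<le> cosh (norm w) * (exp (norm x) - norm x) + sinh (norm w) / norm w * (w \<bullet> x)"
proof -
  define a b where "a = norm w" and "b = norm x"
  have exp_b: "exp b = cosh b + sinh b"
    by (simp add: cosh_def sinh_def field_simps)
  consider "w = 0" | "x = 0" | "w \<noteq> 0" "x \<noteq> 0" by blast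
  then show ?thesis
  proof cases
    \<comment> \<open>Here the quotient \<open>sinh 0 / 0\<close> is 0 by convention, and the claim
      reduces to \<open>b \<le> sinh b\<close>.\<close>
    case 1
    then show ?thesis
      using sinh_ge_self[of b] exp_b by (simp add: b_def)
  next
    case 3
    then have pos: "0 < a" "0 < b" by (simp_all add: a_def b_def)
    define \<tau> where "\<tau> = w \<bullet> x / (a * b)"
    have wx: "w \<bullet> x = a * b * \<tau>" using pos by (simp add: \<tau>_def)
    have "\<bar>w \<bullet> x\<bar> \<le> a * b" unfolding a_def b_def by (rule Cauchy_Schwarz_ineq2)
    then have \<tau>: "\<bar>\<tau>\<bar> \<le> 1" using pos by (simp add: \<tau>_def abs_mult)
    have "(norm (w + x))\<^sup>2 = a\<^sup>2 + b\<^sup>2 + 2 * (w \<bullet> x)"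
      by (simp add: a_def b_def power2_norm_eq_inner inner_add inner_commute)
    \<comment> \<open>With \<open>\<tau>\<close> the cosine of the angle, the squared norm
      interpolates linearly between the antiparallel and the parallel case.\<close>
    also have "\<dots> = (1 - (1 + \<tau>) / 2) * (a - b)\<^sup>2 + (1 + \<tau>) / 2 * (a + b)\<^sup>2"
      by (simp add: wx power2_eq_square field_simps)
    finally have "cosh (norm (w + x))
        \<le> (1 - (1 + \<tau>) / 2) * cosh (a - b) + (1 + \<tau>) / 2 * cosh (a + b)"
      using \<tau> by (intro cosh_convex_square) auto
    also have "\<dots> = cosh a * cosh b + \<tau> * sinh a * sinh b"
      by (simp add: cosh_add cosh_diff field_simps)
    also have "\<tau> * sinh a * sinh b = \<tau> * (sinh a * (sinh b - b)) + \<tau> * sinh a * b"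
      by (simp add: algebra_simps)
    also have "\<tau> * (sinh a * (sinh b - b)) \<le> 1 * (cosh a * (sinh b - b))"
      using \<tau> pos sinh_ge_self[of b] sinh_le_cosh_real[of a]
      by (intro mult_mono mult_right_mono) auto
    also have "\<tau> * sinh a * b = sinh a / a * (w \<bullet> x)"
      using pos by (simp add: wx)
    finally show ?thesis
      by (simp add: exp_b flip: a_def b_def) (simp add: algebra_simps)
  qed simp
qed

text \<open>Bernstein's estimate, cleared of its denominator. The difference \<open>h\<close> of the
  two sides vanishes at 0 together with \<open>h'\<close>, and \<open>h'' \<ge> 0\<close> because
  \<open>(1 - t) exp t \<le> 1\<close>. It holds for all real \<open>x\<close>, so only upper bounds
  on the summands will matter.\<close>

lemma exp_remainder_bound:
  fixes x :: real
  shows "(1 - x / 3) * (exp x - 1 - x) \<le> x\<^sup>2 / 2"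
proof -
  define h where "h = (\<lambda>x :: real. x\<^sup>2 / 2 - (1 - x / 3) * (exp x - 1 - x))"
  define h' where "h' = (\<lambda>x :: real. x + (exp x - 1 - x) / 3 - (1 - x / 3) * (exp x - 1))"
  have h: "(h has_real_derivative h' t) (at t)" for t
    unfolding h_def h'_def by (auto intro!: derivative_eq_intros simp: field_simps)
  have h': "(h' has_real_derivative (1 - exp t + t * exp t) / 3) (at t)" for t
    unfolding h'_def by (auto intro!: derivative_eq_intros simp: field_simps)
  have h'': "0 \<le> (1 - exp t + t * exp t) / 3" for t :: real
  proof -
    have "(1 - t) * exp t \<le> exp (- t) * exp t"
      using exp_ge_add_one_self[of "- t"] by (intro mult_right_mono) auto
    then show ?thesis by (simp add: exp_minus algebra_simps)
  qed
  have mono: "h' s \<le> h' t" if "s \<le> t" for s t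
    using DERIV_nonneg_imp_nondecreasing[OF that] h' h'' by blast
  have "h' 0 = 0" "h 0 = 0" by (simp_all add: h_def h'_def)
  have "0 \<le> h x"
  proof (cases "0 \<le> x")
    case True
    have "h 0 \<le> h x"
      using h mono[of 0] \<open>h' 0 = 0\<close> by (intro DERIV_nonneg_imp_nondecreasing[OF True]) fastforce
    then show ?thesis using \<open>h 0 = 0\<close> by simp
  next
    case False
    have "h 0 \<le> h x"
      using h mono[of _ 0] \<open>h' 0 = 0\<close> False
      by (intro DERIV_nonpos_imp_nonincreasing[of x 0]) fastforce+
    then show ?thesis using \<open>h 0 = 0\<close> by simp
  qed
  then show ?thesis by (simp add: h_def)
qed

lemma exp_le_quadratic:
  fixes x y :: real
  assumes "x \<le> y" "y < 3"
  shows "exp x \<le> 1 + x + x\<^sup>2 / (2 * (1 - y / 3))"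
proof -
  have "exp x - 1 - x \<ge> 0" using exp_ge_add_one_self[of x] by linarith
  then have "(1 - y / 3) * (exp x - 1 - x) \<le> (1 - x / 3) * (exp x - 1 - x)"
    using assms by (intro mult_right_mono) auto
  also have "\<dots> \<le> x\<^sup>2 / 2" by (rule exp_remainder_bound)
  finally show ?thesis
    using assms by (simp add: field_simps)
qed

text \<open>Pinelis' method: \<open>cosh (norm _)\<close> replaces the exponential moment of the scalar case.\<close>

lemma prob_norm_iid_sum_ge:
  fixes x :: "'b::finite \<Rightarrow> 'v::real_inner"
  assumes mean: "(\<Sum>j\<in>UNIV. x j) = 0" and "0 \<le> \<kappa>" and bound: "\<And>j. \<kappa> * norm (x j) \<le> 1"
  shows "measure_pmf.prob (Pi_pmf (UNIV :: 'i::finite set) d (\<lambda>_. pmf_of_set UNIV))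
      {f. r \<le> norm (\<Sum>i\<in>UNIV. x (f i))}
    \<le> 2 * exp (3 / 4 * \<kappa>\<^sup>2 * (real CARD('i) / real CARD('b) * (\<Sum>j\<in>UNIV. (norm (x j))\<^sup>2)) - \<kappa> * r)"
    (is "measure_pmf.prob ?q ?E \<le> _")
proof -
  let ?n1 = "real CARD('b)"
  let ?V = "(\<Sum>j\<in>UNIV. (norm (x j))\<^sup>2) / ?n1"
  let ?y = "\<lambda>j. \<kappa> *\<^sub>R x j"
  let ?\<rho> = "exp (3 / 4 * \<kappa>\<^sup>2 * ?V)"
  have step: "(\<Sum>j\<in>UNIV. cosh (norm (w + ?y j))) / ?n1 \<le> ?\<rho> * cosh (norm w)" for w
  proof -
    have "cosh (norm (w + ?y j)) \<le> cosh (norm w) * (1 + 3 / 4 * \<kappa>\<^sup>2 * (norm (x j))\<^sup>2)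
        + sinh (norm w) / norm w * (w \<bullet> ?y j)" for j
    proof -
      \<comment> \<open>The constant 3/4 is \<open>1 / (2 (1 - 1/3))\<close>, from
        \<open>\<kappa> * norm (x j) \<le> 1\<close>.\<close>
      have "exp (norm (?y j)) - norm (?y j) \<le> 1 + 3 / 4 * (norm (?y j))\<^sup>2"
        using exp_le_quadratic[of "norm (?y j)" 1] bound[of j] \<open>0 \<le> \<kappa>\<close> by simp
      then have "exp (norm (?y j)) - norm (?y j) \<le> 1 + 3 / 4 * \<kappa>\<^sup>2 * (norm (x j))\<^sup>2"
        by (simp add: power_mult_distrib)
      then have "cosh (norm w) * (exp (norm (?y j)) - norm (?y j))
          \<le> cosh (norm w) * (1 + 3 / 4 * \<kappa>\<^sup>2 * (norm (x j))\<^sup>2)"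
        by (intro mult_left_mono) simp_all
      then show ?thesis using cosh_norm_add_le[of w "?y j"] by linarith
    qed
    then have "(\<Sum>j\<in>UNIV. cosh (norm (w + ?y j)))
      \<le> (\<Sum>j\<in>UNIV. cosh (norm w) * (1 + 3 / 4 * \<kappa>\<^sup>2 * (norm (x j))\<^sup>2)
          + sinh (norm w) / norm w * (w \<bullet> ?y j))"
      by (intro sum_mono)
    also have "\<dots> = cosh (norm w) * (\<Sum>j\<in>UNIV. 1 + 3 / 4 * \<kappa>\<^sup>2 * (norm (x j))\<^sup>2)
          + sinh (norm w) / norm w * (w \<bullet> (\<kappa> *\<^sub>R (\<Sum>j\<in>UNIV. x j)))"
      by (subst sum.distrib) (simp only: sum_distrib_left scaleR_sum_right inner_sum_right)
    also have "\<dots> = ?n1 * (cosh (norm w) * (1 + 3 / 4 * \<kappa>\<^sup>2 * ?V))"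
    proof -
      have "(\<Sum>j\<in>UNIV. 1 + 3 / 4 * \<kappa>\<^sup>2 * (norm (x j))\<^sup>2) = ?n1 * (1 + 3 / 4 * \<kappa>\<^sup>2 * ?V)"
        by (subst sum.distrib, subst sum_distrib_left[symmetric]) (simp add: field_simps)
      then show ?thesis by (simp add: mean)
    qed
    finally have "(\<Sum>j\<in>UNIV. cosh (norm (w + ?y j))) / ?n1 \<le> cosh (norm w) * (1 + 3 / 4 * \<kappa>\<^sup>2 * ?V)"
      by (subst pos_divide_le_eq) (simp_all only: mult.commute, simp)
    also have "\<dots> \<le> cosh (norm w) * ?\<rho>"
      by (intro mult_left_mono exp_ge_add_one_self) simp
    finally show ?thesis by (simp add: mult.commute)
  qed
  have "measure_pmf.expectation ?q (\<lambda>f. cosh (norm (\<Sum>i\<in>UNIV. ?y (f i))))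
      \<le> ?\<rho> ^ card (UNIV :: 'i set) * cosh (norm (0 :: 'v))
        + 0 * (\<Sum>j<card (UNIV :: 'i set). ?\<rho> ^ j)"
    by (rule expectation_iid_sum_le[where g = "\<lambda>v. cosh (norm v)" and w = ?y])
      (use step in \<open>simp_all add: integral_pmf_of_set\<close>)
  also have "\<dots> = exp (3 / 4 * \<kappa>\<^sup>2 * (real CARD('i) / ?n1 * (\<Sum>j\<in>UNIV. (norm (x j))\<^sup>2)))"
    by (simp add: exp_of_nat_mult[symmetric] field_simps)
  finally have E: "measure_pmf.expectation ?q (\<lambda>f. cosh (norm (\<Sum>i\<in>UNIV. ?y (f i)))) \<le> \<dots>" .
  have "measure_pmf.prob ?q ?E
      \<le> measure_pmf.expectation ?q (\<lambda>f. cosh (norm (\<Sum>i\<in>UNIV. ?y (f i)))) / (exp (\<kappa> * r) / 2)"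
  proof (rule prob_le_expectation)
    fix f assume "f \<in> ?E"
    then have "\<kappa> * r \<le> norm (\<Sum>i\<in>UNIV. ?y (f i))"
      using \<open>0 \<le> \<kappa>\<close> by (simp add: scaleR_sum_right[symmetric] mult_left_mono)
    then have "exp (\<kappa> * r) / 2 \<le> exp (norm (\<Sum>i\<in>UNIV. ?y (f i))) / 2" by simp
    also have "\<dots> \<le> cosh (norm (\<Sum>i\<in>UNIV. ?y (f i)))" by (simp add: cosh_def)
    finally show "exp (\<kappa> * r) / 2 \<le> cosh (norm (\<Sum>i\<in>UNIV. ?y (f i)))" .
  qed simp_all
  also have "\<dots> \<le> exp (3 / 4 * \<kappa>\<^sup>2 * (real CARD('i) / ?n1 * (\<Sum>j\<in>UNIV. (norm (x j))\<^sup>2)))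
      / (exp (\<kappa> * r) / 2)"
    by (intro divide_right_mono E) simp
  finally show ?thesis
    by (simp only: exp_diff) (simp add: mult.commute)
qed

lemma bernstein_iid:
  fixes x :: "'b::finite \<Rightarrow> real"
  assumes mean: "(\<Sum>j\<in>UNIV. x j) = 0" and bound: "\<And>j. x j \<le> b" and "0 \<le> b"
    and var: "(\<Sum>j\<in>UNIV. (x j)\<^sup>2) \<le> real CARD('b) * v" and "0 < v" "0 < l"
  shows "measure_pmf.prob (Pi_pmf (UNIV :: 'i::finite set) d (\<lambda>_. pmf_of_set UNIV))
      {f. sqrt (2 * real CARD('i) * v * l) + 2 / 3 * b * l \<le> (\<Sum>i\<in>UNIV. x (f i))} \<le> exp (- l)"
    (is "measure_pmf.prob ?q ?E \<le> _")
proof -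
  let ?n1 = "real CARD('b)" and ?m = "real CARD('i)"
  define s where "s = sqrt (2 * ?m * v * l) + 2 / 3 * b * l"
  \<comment> \<open>With \<open>\<kappa> = s / D\<close> the factor
    \<open>1 - \<kappa> b / 3\<close> equals \<open>m v / D\<close>, and the exponent collapses to
    \<open>- s^2 / (2 D)\<close>.\<close>
  define D where "D = ?m * v + b * s / 3"
  define \<kappa> where "\<kappa> = s / D"
  have "0 < s" unfolding s_def using \<open>0 < v\<close> \<open>0 < l\<close> \<open>0 \<le> b\<close>
    by (intro add_pos_nonneg mult_nonneg_nonneg) auto
  have mv: "0 < ?m * v" using \<open>0 < v\<close> by simp
  have "0 < D" unfolding D_def using mv \<open>0 < s\<close> \<open>0 \<le> b\<close>
    by (intro add_pos_nonneg mult_nonneg_nonneg divide_nonneg_pos) auto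
  have "0 < \<kappa>" using \<open>0 < s\<close> \<open>0 < D\<close> by (simp add: \<kappa>_def)
  have lb: "1 - \<kappa> * b / 3 = ?m * v / D"
    using \<open>0 < D\<close> by (simp add: \<kappa>_def field_simps) (simp add: D_def field_simps)
  then have lb3: "\<kappa> * b < 3"
  proof -
    have "0 < 1 - \<kappa> * b / 3" unfolding lb using mv \<open>0 < D\<close> by simp
    then show ?thesis by simp
  qed
  let ?K = "\<kappa>\<^sup>2 * v / (2 * (1 - \<kappa> * b / 3))"
  have step: "(\<Sum>j\<in>UNIV. exp (w + \<kappa> * x j)) / ?n1 \<le> exp ?K * exp w" for w
  proof -
    have "(\<Sum>j\<in>UNIV. exp (\<kappa> * x j))
        \<le> (\<Sum>j\<in>UNIV. 1 + \<kappa> * x j + (\<kappa> * x j)\<^sup>2 / (2 * (1 - \<kappa> * b / 3)))"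
      using bound lb3 \<open>0 < \<kappa>\<close> by (intro sum_mono exp_le_quadratic mult_left_mono) auto
    also have "\<dots> = ?n1 + \<kappa>\<^sup>2 * (\<Sum>j\<in>UNIV. (x j)\<^sup>2) / (2 * (1 - \<kappa> * b / 3))"
      by (simp add: sum.distrib sum_distrib_left[symmetric] sum_divide_distrib[symmetric] mean
          power_mult_distrib)
    also have "\<dots> \<le> ?n1 + \<kappa>\<^sup>2 * (?n1 * v) / (2 * (1 - \<kappa> * b / 3))"
      using var lb3 by (intro add_left_mono divide_right_mono mult_left_mono) auto
    finally have "(\<Sum>j\<in>UNIV. exp (\<kappa> * x j)) / ?n1 \<le> 1 + ?K"
      by (simp add: field_simps)
    also have "\<dots> \<le> exp ?K" by (rule exp_ge_add_one_self)
    finally have "exp w * ((\<Sum>j\<in>UNIV. exp (\<kappa> * x j)) / ?n1) \<le> exp w * exp ?K"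
      by (intro mult_left_mono) simp_all
    then show ?thesis
      by (simp only: exp_add sum_distrib_left[symmetric] times_divide_eq_right mult.commute)
  qed
  have "measure_pmf.expectation ?q (\<lambda>f. exp (\<Sum>i\<in>UNIV. \<kappa> * x (f i)))
      \<le> exp ?K ^ card (UNIV :: 'i set) * exp 0 + 0 * (\<Sum>j<card (UNIV :: 'i set). exp ?K ^ j)"
    by (rule expectation_iid_sum_le[where g = exp and w = "\<lambda>j. \<kappa> * x j"])
      (use step in \<open>simp_all add: integral_pmf_of_set\<close>)
  also have "\<dots> = exp (?m * ?K)"
    by (simp add: exp_of_nat_mult[symmetric])
  finally have E: "measure_pmf.expectation ?q (\<lambda>f. exp (\<Sum>i\<in>UNIV. \<kappa> * x (f i))) \<le> exp (?m * ?K)" .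
  have "measure_pmf.prob ?q ?E
      \<le> measure_pmf.expectation ?q (\<lambda>f. exp (\<Sum>i\<in>UNIV. \<kappa> * x (f i))) / exp (\<kappa> * s)"
    using \<open>0 < \<kappa>\<close> by (intro prob_le_expectation) (auto simp: s_def sum_distrib_left[symmetric])
  also have "\<dots> \<le> exp (?m * ?K) / exp (\<kappa> * s)"
    by (intro divide_right_mono E) simp
  also have "\<dots> = exp (?m * ?K - \<kappa> * s)" by (simp add: exp_diff)
  also have "?m * ?K - \<kappa> * s = - (s\<^sup>2 / (2 * D))"
    unfolding lb using mv \<open>0 < D\<close> \<open>0 < v\<close> by (simp add: \<kappa>_def power2_eq_square field_simps)
  also have "exp \<dots> \<le> exp (- l)"
  proof -
    let ?A = "sqrt (2 * ?m * v * l)"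
    \<comment> \<open>From \<open>s^2 - 2/3 b l s = s ?A \<ge> ?A^2 = 2 m v l\<close> follows
      \<open>s^2 \<ge> 2 l D\<close>, which is why \<open>s\<close> has this shape.\<close>
    have "?A * ?A \<le> s * ?A"
      unfolding s_def using \<open>0 < v\<close> \<open>0 < l\<close> \<open>0 \<le> b\<close> by (intro mult_right_mono) auto
    then have "2 * ?m * v * l \<le> s * ?A" using \<open>0 < v\<close> \<open>0 < l\<close> by simp
    also have "\<dots> = s\<^sup>2 - 2 / 3 * b * l * s" by (simp add: s_def power2_eq_square algebra_simps)
    finally have "l \<le> s\<^sup>2 / (2 * D)"
      using \<open>0 < D\<close> by (simp add: pos_le_divide_eq) (simp add: D_def algebra_simps)
    then show ?thesis by simp
  qed
  finally show ?thesis by (simp add: s_def)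
qed

subsection \<open>Tail bounds for the tubal sample\<close>

text \<open>A union bound over the slices; the factor 2 inside the logarithm even leaves
  \<open>\<delta> / 2\<close>.\<close>

lemma prob_frames_lower_bound_le:
  fixes u :: "'k::finite \<Rightarrow> 'b::finite \<Rightarrow> real ^ 'n"
  assumes iso: "\<And>k. (\<Sum>j\<in>UNIV. outer (u k j)) = mat 1"
    and u: "\<And>k j. (norm (u k j))\<^sup>2 \<le> R" and "0 < R" and \<gamma>: "0 \<le> \<gamma>" "\<gamma> \<le> 1"
    and \<delta>: "0 < \<delta>" "\<delta> \<le> 1"
    and \<gamma>_sq: "2 * real CARD('b) * R * ln (2 * real CARD('n) * real CARD('k) / \<delta>) \<le> \<gamma>\<^sup>2 * real CARD('i)"
  shows "measure_pmf.prob (Pi_pmf (UNIV :: 'i::finite set) d (\<lambda>_. pmf_of_set UNIV))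
      {f. \<exists>k v. v \<noteq> 0 \<and> (\<Sum>i\<in>UNIV. (u k (f i) \<bullet> v)\<^sup>2)
            \<le> (1 - \<gamma>) * (real CARD('i) / real CARD('b)) * (norm v)\<^sup>2}
    \<le> \<delta>"
proof -
  let ?q = "Pi_pmf (UNIV :: 'i set) d (\<lambda>_. pmf_of_set (UNIV :: 'b set))"
  let ?E = "\<lambda>k. {f :: 'i \<Rightarrow> 'b. \<exists>v. v \<noteq> 0 \<and> (\<Sum>i\<in>UNIV. (u k (f i) \<bullet> v)\<^sup>2)
            \<le> (1 - \<gamma>) * (real CARD('i) / real CARD('b)) * (norm v)\<^sup>2}"
  let ?L = "ln (2 * real CARD('n) * real CARD('k) / \<delta>)"
  have L: "?L \<le> \<gamma>\<^sup>2 * real CARD('i) / (2 * real CARD('b) * R)"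
    using \<gamma>_sq \<open>0 < R\<close> by (subst pos_le_divide_eq) (simp_all add: mult_ac)
  have each: "measure_pmf.prob ?q (?E k) \<le> \<delta> / (2 * real CARD('k))" for k
  proof -
    have "measure_pmf.prob ?q (?E k)
        \<le> real CARD('n) * exp (- (\<gamma>\<^sup>2 * real CARD('i) / (2 * real CARD('b) * R)))"
      by (rule prob_frame_lower_bound_le[OF iso u \<open>0 < R\<close> \<gamma>])
    also have "\<dots> \<le> real CARD('n) * exp (- ?L)"
      using L by (intro mult_left_mono) simp_all
    also have "\<dots> = \<delta> / (2 * real CARD('k))"
      using \<delta> by (simp add: exp_minus)
    finally show ?thesis .
  qed
  have "measure_pmf.prob ?q (\<Union>k. ?E k) \<le> (\<Sum>k\<in>UNIV. measure_pmf.prob ?q (?E k))"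
    by (intro measure_pmf.finite_measure_subadditive_finite) auto
  also have "\<dots> \<le> (\<Sum>k\<in>(UNIV :: 'k set). \<delta> / (2 * real CARD('k)))"
    by (intro sum_mono each)
  also have "\<dots> \<le> \<delta>" using \<delta> by simp
  finally show ?thesis
    by (subst (asm) Collect_ex_eq[symmetric])
qed

context
  fixes z :: "'b::finite \<Rightarrow> real" and Z S v l \<alpha> :: real
  assumes z: "\<And>j. 0 \<le> z j" "\<And>j. z j \<le> Z" and S: "S = (\<Sum>j\<in>UNIV. z j)" "0 < S" and "0 < l"
  defines "v \<equiv> real CARD('b) * Z / S - 1"
begin

text \<open>Normalised by the mean \<open>S / n1\<close>. In this scale \<open>v\<close> bounds both
  the deviations from above and their mean square, which is why the two terms of \<alpha> share one
  ratio.\<close>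

definition deviation :: "'b \<Rightarrow> real" where
  "deviation j = real CARD('b) * z j / S - 1"

lemma sum_deviation: "(\<Sum>j\<in>UNIV. deviation j) = 0"
  using S(2) by (simp add: deviation_def sum_subtractf sum_distrib_left[symmetric]
      sum_divide_distrib[symmetric] S(1)[symmetric])

lemma deviation_le: "deviation j \<le> v"
  unfolding deviation_def v_def using z S
  by (intro diff_right_mono divide_right_mono mult_left_mono) auto

lemma deviation_ge: "- deviation j \<le> 1"
  using z S(2) by (simp add: deviation_def)

lemma variance_nonneg: "0 \<le> v"
proof (rule ccontr)
  assume "\<not> 0 \<le> v"
  then have "deviation j < 0" for j using deviation_le[of j] by linarith
  then have "(\<Sum>j\<in>UNIV. deviation j) < (\<Sum>j\<in>(UNIV :: 'b set). 0)"
    by (intro sum_strict_mono) auto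
  then show False using sum_deviation by simp
qed

text \<open>A Bhatia-Davis estimate: values between -1 and \<open>v\<close> with mean 0 have
  variance at most \<open>1 * v\<close>.\<close>

lemma sum_deviation_square: "(\<Sum>j\<in>UNIV. (deviation j)\<^sup>2) \<le> real CARD('b) * v"
proof -
  have "(deviation j)\<^sup>2 \<le> v * (deviation j + 1) - deviation j" for j
  proof -
    have "(deviation j + 1) * deviation j \<le> (deviation j + 1) * v"
      using deviation_ge[of j] by (intro mult_left_mono deviation_le) linarith
    then show ?thesis by (simp add: power2_eq_square algebra_simps)
  qed
  then have "(\<Sum>j\<in>UNIV. (deviation j)\<^sup>2) \<le> (\<Sum>j\<in>UNIV. v * (deviation j + 1) - deviation j)"
    by (intro sum_mono)
  also have "\<dots> = real CARD('b) * v"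
    by (simp add: sum_subtractf sum.distrib sum_distrib_left[symmetric] sum_deviation)
  finally show ?thesis .
qed

text \<open>Handles the degenerate case, since \<open>bernstein_iid\<close> asks for a positive
  variance bound.\<close>

lemma deviation_eq_0: "v = 0 \<Longrightarrow> deviation j = 0"
proof -
  assume "v = 0"
  then have "(\<Sum>j\<in>UNIV. (deviation j)\<^sup>2) = 0"
    using sum_deviation_square by (intro order.antisym sum_nonneg) simp_all
  then show "deviation j = 0"
    by (simp add: sum_nonneg_eq_0_iff)
qed

lemma sum_deviation_sample:
  "(\<Sum>i\<in>UNIV. deviation (f i)) = real CARD('b) / S * (\<Sum>i\<in>UNIV. z (f i)) - real CARD('i)"
  for f :: "'i::finite \<Rightarrow> 'b"
  by (simp add: deviation_def sum_subtractf sum_distrib_left[symmetric]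
      sum_divide_distrib[symmetric])

lemma prob_sample_sum_tails:
  assumes \<alpha>: "\<alpha> = sqrt (2 * v / real CARD('i) * l) + 2 * v / (3 * real CARD('i)) * l"
  shows "measure_pmf.prob (Pi_pmf (UNIV :: 'i::finite set) d (\<lambda>_. pmf_of_set UNIV))
      {f. (1 + \<alpha>) * (real CARD('i) / real CARD('b)) * S < (\<Sum>i\<in>UNIV. z (f i))} \<le> exp (- l)"
    (is "measure_pmf.prob ?q ?E \<le> _")
    and "measure_pmf.prob (Pi_pmf (UNIV :: 'i::finite set) d (\<lambda>_. pmf_of_set UNIV))
      {f. (\<Sum>i\<in>UNIV. z (f i)) < (real CARD('i) * (1 - \<alpha>) - 2 / 3 * l) / real CARD('b) * S}
      \<le> exp (- l)"
    (is "measure_pmf.prob ?q ?F \<le> _")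
proof -
  let ?m = "real CARD('i)" and ?n1 = "real CARD('b)"
  have m: "0 < ?m" and n1: "0 < ?n1" by simp_all
  have \<alpha>_m: "?m * \<alpha> = sqrt (2 * ?m * v * l) + 2 / 3 * v * l"
  proof -
    have "?m * sqrt (2 * v / ?m * l) = sqrt (?m\<^sup>2 * (2 * v / ?m * l))"
      using m by (subst real_sqrt_mult) simp
    also have "?m\<^sup>2 * (2 * v / ?m * l) = 2 * ?m * v * l"
      using m by (simp add: power2_eq_square)
    finally show ?thesis
      using m by (simp add: \<alpha> distrib_left)
  qed
  have E: "?m * \<alpha> < (\<Sum>i\<in>UNIV. deviation (f i))" if "f \<in> ?E" for f
  proof -
    have "?n1 / S * ((1 + \<alpha>) * (?m / ?n1) * S) < ?n1 / S * (\<Sum>i\<in>UNIV. z (f i))"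
      using that S(2) n1 by (intro mult_strict_left_mono) simp_all
    moreover have "?n1 / S * ((1 + \<alpha>) * (?m / ?n1) * S) = ?m + ?m * \<alpha>"
      using S(2) by (simp add: field_simps)
    ultimately show ?thesis
      unfolding sum_deviation_sample by linarith
  qed
  have F: "?m * \<alpha> + 2 / 3 * l < (\<Sum>i\<in>UNIV. - deviation (f i))" if "f \<in> ?F" for f
  proof -
    have "?n1 / S * (\<Sum>i\<in>UNIV. z (f i)) < ?n1 / S * ((?m * (1 - \<alpha>) - 2 / 3 * l) / ?n1 * S)"
      using that S(2) n1 by (intro mult_strict_left_mono) simp_all
    moreover have "?n1 / S * ((?m * (1 - \<alpha>) - 2 / 3 * l) / ?n1 * S) = ?m - ?m * \<alpha> - 2 / 3 * l"
      using S(2) by (simp add: field_simps)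
    ultimately show ?thesis
      unfolding sum_negf sum_deviation_sample by linarith
  qed
  have \<alpha>0: "0 \<le> ?m * \<alpha>"
    unfolding \<alpha>_m using variance_nonneg \<open>0 < l\<close> by (intro add_nonneg_nonneg) auto
  show "measure_pmf.prob ?q ?E \<le> exp (- l)"
  proof (cases "v = 0")
    case True
    then have "?E = {}" using E \<alpha>0 deviation_eq_0 by fastforce
    then show ?thesis by simp
  next
    case False
    then have "0 < v" using variance_nonneg by simp
    have "measure_pmf.prob ?q ?E \<le> measure_pmf.prob ?q
        {f. sqrt (2 * ?m * v * l) + 2 / 3 * v * l \<le> (\<Sum>i\<in>UNIV. deviation (f i))}"
      using E \<alpha>_m by (intro measure_pmf.finite_measure_mono) (auto intro: less_imp_le)
    also have "\<dots> \<le> exp (- l)"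
      by (intro bernstein_iid sum_deviation deviation_le variance_nonneg sum_deviation_square
          \<open>0 < v\<close> \<open>0 < l\<close>)
    finally show ?thesis .
  qed
  show "measure_pmf.prob ?q ?F \<le> exp (- l)"
  proof (cases "v = 0")
    case True
    then have "?F = {}" using F \<alpha>0 deviation_eq_0 \<open>0 < l\<close> by fastforce
    then show ?thesis by simp
  next
    case False
    then have "0 < v" using variance_nonneg by simp
    then have "0 \<le> 2 / 3 * v * l" using \<open>0 < l\<close> by simp
    then have "measure_pmf.prob ?q ?F \<le> measure_pmf.prob ?q
        {f. sqrt (2 * ?m * v * l) + 2 / 3 * 1 * l \<le> (\<Sum>i\<in>UNIV. - deviation (f i))}"
    proof (intro measure_pmf.finite_measure_mono subsetI CollectI)
      fix f assume "f \<in> ?F"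
      from F[OF this] show "sqrt (2 * ?m * v * l) + 2 / 3 * 1 * l \<le> (\<Sum>i\<in>UNIV. - deviation (f i))"
        using \<alpha>_m \<open>0 \<le> 2 / 3 * v * l\<close> by linarith
    qed simp
    also have "\<dots> \<le> exp (- l)"
      using sum_deviation sum_deviation_square
      by (intro bernstein_iid deviation_ge \<open>0 < v\<close> \<open>0 < l\<close>) (simp_all add: sum_negf)
    finally show ?thesis .
  qed
qed

end

text \<open>
  The term \<open>2 / 3 * l\<close> subtracted from the expected threshold is the slack which compensates for
  the lower Bernstein bound, where the deviations are bounded by 1 and not by their variance.
\<close>

lemma prob_norm_sample_sum_gt:
  fixes x :: "'b::finite \<Rightarrow> 'v::real_inner"
  assumes mean: "(\<Sum>j\<in>UNIV. x j) = 0" and x: "\<And>j. (norm (x j))\<^sup>2 \<le> R * z j"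
    and z: "\<And>j. z j \<le> Z" and S: "S = (\<Sum>j\<in>UNIV. z j)" "0 < S" and "0 < R" "1 \<le> l"
    and small: "l * (real CARD('b) * Z) \<le> real CARD('i) * S"
  shows "measure_pmf.prob (Pi_pmf (UNIV :: 'i::finite set) d (\<lambda>_. pmf_of_set UNIV))
      {f. real CARD('i) / real CARD('b) * R * ((1 + 2 * sqrt l)\<^sup>2 - 2 / 3 * l) * S
            < (norm (\<Sum>i\<in>UNIV. x (f i)))\<^sup>2} \<le> exp (- l)"
    (is "measure_pmf.prob ?q ?E \<le> _")
proof -
  let ?m = "real CARD('i)" and ?n1 = "real CARD('b)"
  define \<sigma> where "\<sigma> = sqrt (?m / ?n1 * R * S)"
  define s where "s = sqrt l"
  have s: "1 \<le> s" "s\<^sup>2 = l" using \<open>1 \<le> l\<close> by (simp_all add: s_def)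
  have \<sigma>2: "\<sigma>\<^sup>2 = ?m / ?n1 * R * S" and \<sigma>: "0 < \<sigma>"
    unfolding \<sigma>_def using S \<open>0 < R\<close> by simp_all
  \<comment> \<open>The exponent parameter will be \<open>\<kappa> = s / \<sigma>\<close>, with
    \<open>\<sigma>^2\<close> bounding the total variance. Pinelis' method asks for
    \<open>\<kappa> * norm (x j) \<le> 1\<close>, which is what \<open>small\<close>
    provides.\<close>
  have bound: "s / \<sigma> * norm (x j) \<le> 1" for j
  proof -
    have "l * (norm (x j))\<^sup>2 \<le> l * (R * Z)"
      using x[of j] z[of j] \<open>0 < R\<close> \<open>1 \<le> l\<close>
      by (intro mult_left_mono) (auto intro: order_trans mult_left_mono)
    also have "\<dots> = (l * (?n1 * Z)) * (R / ?n1)" by simp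
    also have "\<dots> \<le> (?m * S) * (R / ?n1)"
      using small \<open>0 < R\<close> by (intro mult_right_mono) simp_all
    also have "\<dots> = \<sigma>\<^sup>2" by (simp add: \<sigma>2)
    finally have "(s * norm (x j))\<^sup>2 \<le> \<sigma>\<^sup>2" by (simp add: power_mult_distrib s)
    then have "s * norm (x j) \<le> \<sigma>" by (rule power2_le_imp_le) (use \<sigma> in simp)
    then show ?thesis using \<sigma> by simp
  qed
  \<comment> \<open>9/5 lies between 7/4, from where on the exponent drops below
    \<open>- l - 1\<close>, and the root of \<open>10/3 = 4 - 2/3\<close>, up to which the square
    fits under the reduced threshold.\<close>
  let ?r = "\<sigma> * (1 + 9 / 5 * s)"
  let ?V = "?m / ?n1 * (\<Sum>j\<in>UNIV. (norm (x j))\<^sup>2)"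
  have V: "?V \<le> \<sigma>\<^sup>2"
  proof -
    have "(\<Sum>j\<in>UNIV. (norm (x j))\<^sup>2) \<le> R * S"
      unfolding S sum_distrib_left by (intro sum_mono x)
    then have "?V \<le> ?m / ?n1 * (R * S)" by (intro mult_left_mono) simp_all
    then show ?thesis by (simp add: \<sigma>2)
  qed
  have "?r \<le> norm (\<Sum>i\<in>UNIV. x (f i))" if "f \<in> ?E" for f
  proof -
    have "(1 + 9 / 5 * s)\<^sup>2 \<le> (1 + 2 * s)\<^sup>2 - 2 / 3 * s\<^sup>2"
    proof -
      have "(1 + 2 * s)\<^sup>2 - 2 / 3 * s\<^sup>2 - (1 + 9 / 5 * s)\<^sup>2 = 2 / 5 * s + 7 / 75 * s\<^sup>2"
        by (simp add: power2_eq_square algebra_simps)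
      moreover have "0 \<le> 2 / 5 * s + 7 / 75 * s\<^sup>2"
        using s(1) by simp
      ultimately show ?thesis by linarith
    qed
    then have "?r\<^sup>2 \<le> \<sigma>\<^sup>2 * ((1 + 2 * s)\<^sup>2 - 2 / 3 * s\<^sup>2)"
      by (simp add: power_mult_distrib mult_left_mono)
    also have "\<dots> < (norm (\<Sum>i\<in>UNIV. x (f i)))\<^sup>2"
      using that by (simp add: \<sigma>2 s(2) s_def[symmetric] mult_ac)
    finally have "?r\<^sup>2 \<le> (norm (\<Sum>i\<in>UNIV. x (f i)))\<^sup>2" by simp
    then show ?thesis by (rule power2_le_imp_le) simp
  qed
  then have "measure_pmf.prob ?q ?E \<le> measure_pmf.prob ?q {f. ?r \<le> norm (\<Sum>i\<in>UNIV. x (f i))}"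
    by (intro measure_pmf.finite_measure_mono) auto
  also have "\<dots> \<le> 2 * exp (3 / 4 * (s / \<sigma>)\<^sup>2 * ?V - s / \<sigma> * ?r)"
    using \<sigma> s by (intro prob_norm_iid_sum_ge mean bound) simp
  \<comment> \<open>The extra \<open>- 1\<close> comes from the summand 1 in \<open>?r\<close> and
    \<open>s \<ge> 1\<close>; it absorbs the prefactor 2 left by \<open>cosh\<close>.\<close>
  also have "\<dots> \<le> exp 1 * exp (- l - 1)"
  proof (intro mult_mono)
    show "2 \<le> exp (1 :: real)" using exp_ge_add_one_self[of 1] by simp
    have "3 / 4 * (s / \<sigma>)\<^sup>2 * ?V \<le> 3 / 4 * (s / \<sigma>)\<^sup>2 * \<sigma>\<^sup>2"
      by (intro mult_left_mono V) simp
    also have "\<dots> = 3 / 4 * l" using \<sigma> s by (simp add: power_divide)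
    finally have "3 / 4 * (s / \<sigma>)\<^sup>2 * ?V \<le> 3 / 4 * l" .
    moreover have "s / \<sigma> * ?r = s + 9 / 5 * l"
      using \<sigma> s(2) by (simp add: power2_eq_square algebra_simps)
    ultimately have "3 / 4 * (s / \<sigma>)\<^sup>2 * ?V - s / \<sigma> * ?r \<le> - l - 1"
      using s(1) \<open>1 \<le> l\<close> by linarith
    then show "exp (3 / 4 * (s / \<sigma>)\<^sup>2 * ?V - s / \<sigma> * ?r) \<le> exp (- l - 1)"
      by (simp only: exp_le_cancel_iff)
  qed simp_all
  also have "\<dots> = exp (- l)" by (simp flip: exp_add)
  finally show ?thesis .
qed

subsection \<open>Slices in the transform domain\<close>

lemma norm_square_vec: "(norm V)\<^sup>2 = (\<Sum>i\<in>UNIV. (norm (V $ i))\<^sup>2)"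
  for V :: "('d::real_normed_vector) ^ 'e"
  by (simp add: norm_vec_def L2_set_def sum_nonneg)

abbreviation tensor_slice :: "real ^ 'n3 ^ 'n3 \<Rightarrow> real ^ 'n3 ^ 'n2 ^ 'n1 \<Rightarrow> 'n3 \<Rightarrow> real ^ 'n2 ^ 'n1" where
  "tensor_slice M A k \<equiv> frontal_slice (tensor_transform M A) k"

lemma tensor_slice_nth: "tensor_slice M A k $ i $ j = (M *v (A $ i $ j)) $ k"
  by (simp add: frontal_slice_def tensor_transform_def)

lemma tensor_slice_diff: "tensor_slice M (A - B) k = tensor_slice M A k - tensor_slice M B k"
  by (simp add: vec_eq_iff tensor_slice_nth matrix_vector_mult_diff_distrib)

lemma tensor_slice_add: "tensor_slice M (A + B) k = tensor_slice M A k + tensor_slice M B k"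
  by (simp add: vec_eq_iff tensor_slice_nth matrix_vector_right_distrib)

lemma tensor_slice_zero: "tensor_slice M 0 k = 0"
  by (simp add: vec_eq_iff tensor_slice_nth)

lemma tensor_slice_restrict:
  "tensor_slice M (tubal_restrict \<Omega> A) k = (\<chi> i. tensor_slice M A k $ \<Omega> i)"
  by (simp add: vec_eq_iff tensor_slice_nth tubal_restrict_def)

context
  fixes M :: "real ^ 'n3 ^ 'n3"
  assumes inv: "invertible M"
begin

lemma transform_inverse: "M *v tube_inv_transform M a = a"
proof -
  have "M ** matrix_inv M = mat 1"
    using inv unfolding invertible_def matrix_inv_def by (rule someI2_ex) simp
  then show ?thesis
    by (simp add: tube_inv_transform_def matrix_vector_mul_assoc)
qed

lemma inverse_transform: "tube_inv_transform M (M *v a) = a"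
proof -
  have "matrix_inv M ** M = mat 1"
    using inv unfolding invertible_def matrix_inv_def by (rule someI2_ex) simp
  then show ?thesis
    by (simp add: tube_inv_transform_def matrix_vector_mul_assoc)
qed

lemma tensor_eq_iff_slices: "A = B \<longleftrightarrow> (\<forall>k. tensor_slice M A k = tensor_slice M B k)"
proof
  assume "\<forall>k. tensor_slice M A k = tensor_slice M B k"
  then have "M *v (A $ i $ j) = M *v (B $ i $ j)" for i j
    unfolding vec_eq_iff by (metis tensor_slice_nth)
  then have "A $ i $ j = B $ i $ j" for i j
    by (metis inverse_transform)
  then show "A = B" by (simp add: vec_eq_iff)
qed simp

lemma ex_tensor_slices: "\<exists>A. \<forall>k. tensor_slice M A k = F k"
  by (intro exI[of _ "\<chi> i j. tube_inv_transform M (\<chi> k. F k $ i $ j)"])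
    (simp add: vec_eq_iff tensor_slice_nth transform_inverse)

text \<open>Together with \<open>tensor_eq_iff_slices\<close> and \<open>ex_tensor_slices\<close>
  this makes the tensor algebra a direct product of matrix algebras, one for each slice.\<close>

lemma tensor_slice_prod:
  "tensor_slice M (tensor_prod M A B) k = tensor_slice M A k ** tensor_slice M B k"
  by (simp add: vec_eq_iff tensor_slice_nth tensor_prod_def tube_prod_def transform_inverse
      matrix_matrix_mult_def linear_sum[OF matrix_vector_mul_linear] sum_component)

lemma tensor_slice_transpose:
  "tensor_slice M (tensor_transpose M A) k = transpose (tensor_slice M A k)"
  by (rule frontal_slice_tensor_transpose[OF inv])

lemma tensor_slice_id: "tensor_slice M (tensor_id M) k = mat 1"
  by (simp add: vec_eq_iff tensor_slice_nth tensor_id_def unit_tube_def transform_inverse mat_def)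

lemma is_tensor_inverse_iff:
  "is_tensor_inverse M A B \<longleftrightarrow> (\<forall>k. tensor_slice M A k ** tensor_slice M B k = mat 1 \<and>
     tensor_slice M B k ** tensor_slice M A k = mat 1)"
  unfolding is_tensor_inverse_def tensor_eq_iff_slices tensor_slice_prod tensor_slice_id by blast

lemma tensor_invertible_iff:
  "tensor_invertible M A \<longleftrightarrow> (\<forall>k. invertible (tensor_slice M A k))"
proof
  assume "tensor_invertible M A"
  then show "\<forall>k. invertible (tensor_slice M A k)"
    unfolding tensor_invertible_def is_tensor_inverse_iff invertible_def by blast
next
  assume "\<forall>k. invertible (tensor_slice M A k)"
  then obtain F where "\<And>k. tensor_slice M A k ** F k = mat 1 \<and> F k ** tensor_slice M A k = mat 1"
    unfolding invertible_def by metis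
  then show "tensor_invertible M A"
    unfolding tensor_invertible_def is_tensor_inverse_iff using ex_tensor_slices[of F] by metis
qed

lemma tensor_slice_inv:
  assumes "tensor_invertible M A"
  shows "tensor_slice M A k ** tensor_slice M (tensor_inv M A) k = mat 1"
proof -
  have "is_tensor_inverse M A (tensor_inv M A)"
    using assms unfolding tensor_invertible_def tensor_inv_def by (rule someI_ex)
  then show ?thesis by (simp add: is_tensor_inverse_iff)
qed

lemma tensor_slice_projection:
  "tensor_slice M (projection M A) k = tensor_slice M A k **
     tensor_slice M (tensor_inv M (tensor_prod M (tensor_transpose M A) A)) k **
     transpose (tensor_slice M A k)"
  by (simp add: projection_def tensor_slice_prod tensor_slice_transpose)

lemma column_subspace_slice:
  assumes "X \<in> column_subspace M U"
  obtains C where "tensor_slice M X k = tensor_slice M U k ** C"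
proof -
  obtain C where X: "X = (\<Sum>j\<in>UNIV. tensor_prod M (tensor_column U j) (C j))"
    using assms by (auto simp: column_subspace_def)
  have sum: "tensor_slice M (\<Sum>j\<in>J. V j) k = (\<Sum>j\<in>J. tensor_slice M (V j) k)"
    for J and V :: "'b \<Rightarrow> real ^ 'n3 ^ 1 ^ 'c"
    by (induction J rule: infinite_finite_induct) (simp_all add: tensor_slice_add tensor_slice_zero)
  have "tensor_slice M X k = tensor_slice M U k ** (\<chi> j l. tensor_slice M (C j) k $ 1 $ l)"
    unfolding X sum
    by (simp add: vec_eq_iff tensor_slice_prod matrix_matrix_mult_def tensor_slice_nth
        tensor_column_def UNIV_1 sum_component)
  then show ?thesis by (rule that)
qed

lemma norm_tensor_slices:
  assumes c: "\<And>a. norm (M *v a) = c * norm a"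
  shows "c\<^sup>2 * (norm A)\<^sup>2 = (\<Sum>k\<in>UNIV. (norm (tensor_slice M A k))\<^sup>2)"
proof -
  have "c\<^sup>2 * (norm A)\<^sup>2 = (\<Sum>i\<in>UNIV. \<Sum>j\<in>UNIV. (norm (M *v (A $ i $ j)))\<^sup>2)"
    unfolding c power_mult_distrib by (simp add: norm_square_vec[of A] norm_square_vec[of "A $ _"] sum_distrib_left)
  also have "\<dots> = (\<Sum>i\<in>UNIV. \<Sum>j\<in>UNIV. \<Sum>k\<in>UNIV. (tensor_slice M A k $ i $ j)\<^sup>2)"
    by (simp add: norm_square_vec tensor_slice_nth)
  also have "\<dots> = (\<Sum>i\<in>UNIV. \<Sum>k\<in>UNIV. \<Sum>j\<in>UNIV. (tensor_slice M A k $ i $ j)\<^sup>2)"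
    by (intro sum.cong refl sum.swap)
  also have "\<dots> = (\<Sum>k\<in>UNIV. \<Sum>i\<in>UNIV. \<Sum>j\<in>UNIV. (tensor_slice M A k $ i $ j)\<^sup>2)"
    by (rule sum.swap)
  also have "\<dots> = (\<Sum>k\<in>UNIV. (norm (tensor_slice M A k))\<^sup>2)"
    by (simp add: norm_square_vec)
  finally show ?thesis .
qed

end

lemma norm_single_column: "norm V = norm (column 1 (V :: real ^ 1 ^ 'm))"
  by (simp add: norm_vec_def column_def UNIV_1 L2_set_def)

lemma column_mult: "column j (A ** B) = A *v column j B"
  by (simp add: vec_eq_iff column_def matrix_matrix_mult_def matrix_vector_mult_def)

lemma column_diff: "column j (A - B) = column j A - column j B"
  by (simp add: vec_eq_iff column_def)

context
  fixes A :: "real ^ 'n ^ 'm" and H :: "real ^ 'n ^ 'n"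
  assumes H: "(transpose A ** A) ** H = mat 1"
begin

text \<open>\<open>A H A^T\<close> fixes the range of \<open>A\<close>, since a one-sided inverse of
  a square matrix is two-sided. In the sample this removes the component \<open>X\<close>.\<close>

lemma residual_invariant:
  "(y + A *v c) - (A ** H ** transpose A) *v (y + A *v c) = y - (A ** H ** transpose A) *v y"
proof -
  have "H ** (transpose A ** A) = mat 1"
    using H matrix_left_right_inverse by blast
  then have "(A ** H ** transpose A) ** A = A"
    by (metis matrix_mul_assoc matrix_mul_rid)
  then show ?thesis
    by (simp add: matrix_vector_right_distrib matrix_vector_mul_assoc)
qed

text \<open>Pythagoras: \<open>z = H w\<close> satisfies \<open>A^T A z = w\<close>, so the fitted
  part \<open>A z\<close> is orthogonal to the residual.\<close>

lemma norm_residual: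
  fixes y :: "real ^ 'm"
  defines "w \<equiv> transpose A *v y"
  shows "(norm (y - (A ** H ** transpose A) *v y))\<^sup>2 = (norm y)\<^sup>2 - (norm (A *v (H *v w)))\<^sup>2"
    and "(norm (A *v (H *v w)))\<^sup>2 = (H *v w) \<bullet> w"
proof -
  let ?z = "H *v w"
  have adj: "(A *v a) \<bullet> b = a \<bullet> (transpose A *v b)" for a :: "real ^ 'n" and b
    by (metis dot_lmul_matrix inner_commute transpose_matrix_vector)
  have "transpose A *v (A *v ?z) = w"
    using H by (simp add: matrix_vector_mul_assoc matrix_mul_assoc)
  then show zw: "(norm (A *v ?z))\<^sup>2 = ?z \<bullet> w"
    by (simp add: power2_norm_eq_inner adj)
  have "(A ** H ** transpose A) *v y = A *v ?z"
    by (simp only: w_def matrix_vector_mul_assoc matrix_mul_assoc)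
  then have "(norm (y - (A ** H ** transpose A) *v y))\<^sup>2
      = (norm y)\<^sup>2 - 2 * ((A *v ?z) \<bullet> y) + (norm (A *v ?z))\<^sup>2"
    by (simp add: power2_norm_eq_inner inner_diff_left inner_diff_right inner_commute)
  also have "(A *v ?z) \<bullet> y = (norm (A *v ?z))\<^sup>2"
    unfolding zw by (simp only: adj w_def)
  finally show "(norm (y - (A ** H ** transpose A) *v y))\<^sup>2 = (norm y)\<^sup>2 - (norm (A *v ?z))\<^sup>2"
    by simp
qed

lemma norm_residual_le: "(norm (y - (A ** H ** transpose A) *v y))\<^sup>2 \<le> (norm y)\<^sup>2"
  by (simp add: norm_residual)

text \<open>From \<open>s |z|^2 \<le> |A z|^2 = z . w \<le> |z| |w|\<close> one gets
  \<open>|z| \<le> |w| / s\<close>, hence \<open>|A z|^2 \<le> |w|^2 / s\<close> without an operator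
  norm of \<open>H\<close>.\<close>

lemma norm_residual_ge:
  assumes "0 < s" and s: "\<And>v. s * (norm v)\<^sup>2 \<le> (norm (A *v v))\<^sup>2"
  shows "(norm y)\<^sup>2 - (norm (transpose A *v y))\<^sup>2 / s
    \<le> (norm (y - (A ** H ** transpose A) *v y))\<^sup>2"
proof -
  let ?w = "transpose A *v y"
  let ?z = "H *v ?w"
  have zw: "?z \<bullet> ?w \<le> norm ?z * norm ?w" by (rule norm_cauchy_schwarz)
  have "s * (norm ?z)\<^sup>2 \<le> norm ?z * norm ?w"
    using s[of ?z] zw norm_residual(2)[of y] by simp
  then have "s * norm ?z \<le> norm ?w"
    by (cases "norm ?z = 0") (auto simp: power2_eq_square)
  then have "norm ?z * norm ?w \<le> norm ?w / s * norm ?w"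
    using \<open>0 < s\<close> by (intro mult_right_mono) (simp_all add: field_simps)
  then show ?thesis
    using zw norm_residual[of y] by (simp add: power2_eq_square)
qed

end

context
  fixes M :: "real ^ 'n3 ^ 'n3" and U :: "real ^ 'n3 ^ 'n2 ^ 'n1" and c :: real
  assumes inv: "invertible M" and c: "\<And>a. norm (M *v a) = c * norm a" "0 < c"
begin

lemma norm_column_tensor:
  "c\<^sup>2 * (norm Y)\<^sup>2 = (\<Sum>j\<in>UNIV. (norm (M *v (Y $ j $ 1)))\<^sup>2)"
  for Y :: "real ^ 'n3 ^ 1 ^ 'a"
  unfolding c(1)
  by (simp add: norm_square_vec[of Y] norm_square_vec[of "Y $ _"] UNIV_1 power_mult_distrib
      sum_distrib_left)

lemma norm_column_tensor_slices:
  "c\<^sup>2 * (norm Y)\<^sup>2 = (\<Sum>k\<in>UNIV. (norm (column 1 (tensor_slice M Y k)))\<^sup>2)"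
  for Y :: "real ^ 'n3 ^ 1 ^ 'a"
  by (simp add: norm_tensor_slices[OF inv c(1)] norm_single_column)

lemma slice_orthogonal:
  assumes "Y \<in> orthogonal_subspace M U"
  shows "transpose (tensor_slice M U k) ** tensor_slice M Y k = 0"
proof -
  have "tensor_slice M (tensor_prod M (tensor_transpose M U) Y) k = 0"
    using assms by (simp add: orthogonal_subspace_def tensor_slice_zero)
  then show ?thesis
    by (simp only: tensor_slice_prod[OF inv] tensor_slice_transpose[OF inv])
qed

context
  assumes orthonormal: "tensor_prod M (tensor_transpose M U) U = tensor_id M"
begin

lemma slice_orthonormal: "transpose (tensor_slice M U k) ** tensor_slice M U k = mat 1"
proof -
  have "tensor_slice M (tensor_prod M (tensor_transpose M U) U) k = mat 1"
    by (simp only: orthonormal tensor_slice_id[OF inv])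
  then show ?thesis
    by (simp only: tensor_slice_prod[OF inv] tensor_slice_transpose[OF inv])
qed

lemma slice_projection_orthonormal:
  "tensor_slice M (projection M U) k = tensor_slice M U k ** transpose (tensor_slice M U k)"
proof -
  have "tensor_invertible M (tensor_id M :: real ^ 'n3 ^ 'n2 ^ 'n2)"
    unfolding tensor_invertible_iff[OF inv] tensor_slice_id[OF inv] invertible_def
    by (intro allI exI[of _ "mat 1"]) simp
  then have "tensor_slice M (tensor_inv M (tensor_id M :: real ^ 'n3 ^ 'n2 ^ 'n2)) k = mat 1"
    using tensor_slice_inv[OF inv, of "tensor_id M" k] by (simp add: tensor_slice_id[OF inv])
  then show ?thesis
    by (simp add: tensor_slice_projection[OF inv] orthonormal)
qed

text \<open>Orthonormal columns read by rows: this is the isotropy hypothesis of the matrix Chernoff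
  bound.\<close>

lemma sum_outer_rows: "(\<Sum>j\<in>UNIV. outer (tensor_slice M U k $ j)) = mat 1"
  using slice_orthonormal[of k]
  by (simp add: outer_def vec_eq_iff matrix_matrix_mult_def transpose_def)

text \<open>In a slice \<open>A\<close> the projected unit column is \<open>A A^T e_j\<close>, the
  image of row \<open>j\<close> under the isometry \<open>A\<close>. Thus coherence controls row
  lengths.\<close>

lemma norm_projection_unit_column:
  "c\<^sup>2 * (norm (tensor_prod M (projection M U) (unit_column M j)))\<^sup>2
    = (\<Sum>k\<in>UNIV. (norm (tensor_slice M U k $ j))\<^sup>2)"
  unfolding norm_column_tensor_slices
proof (intro sum.cong refl)
  fix k
  let ?A = "tensor_slice M U k"
  have "column 1 (tensor_slice M (unit_column M j) k) = axis j 1"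
    by (simp add: vec_eq_iff column_def tensor_slice_nth unit_column_def unit_tube_def
        transform_inverse[OF inv] axis_def)
  then have "column 1 (tensor_slice M (tensor_prod M (projection M U) (unit_column M j)) k)
      = ?A *v (transpose ?A *v axis j 1)"
    by (simp only: tensor_slice_prod[OF inv] slice_projection_orthonormal column_mult
        matrix_vector_mul_assoc)
  also have "transpose ?A *v axis j 1 = ?A $ j"
    by (simp add: matrix_vector_mult_basis column_def transpose_def)
  also have "(norm (?A *v (?A $ j)))\<^sup>2 = (norm (?A $ j))\<^sup>2"
  proof -
    have "(?A *v w) \<bullet> (?A *v w) = w \<bullet> (transpose ?A *v (?A *v w))" for w
      by (metis dot_lmul_matrix inner_commute transpose_matrix_vector)
    then show ?thesis
      by (simp only: power2_norm_eq_inner matrix_vector_mul_assoc slice_orthonormal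
          matrix_vector_mul_lid)
  qed
  finally show "(norm (column 1 (tensor_slice M (tensor_prod M (projection M U)
      (unit_column M j)) k)))\<^sup>2 = (norm (?A $ j))\<^sup>2"
    by simp
qed

lemma sum_norm_rows_le_coherence:
  "(\<Sum>k\<in>UNIV. (norm (tensor_slice M U k $ j))\<^sup>2)
    \<le> c\<^sup>2 * real CARD('n2) * coherence M U / real CARD('n1)"
proof -
  have "(norm (tensor_prod M (projection M U) (unit_column M j)))\<^sup>2
      \<le> (MAX j. (norm (tensor_prod M (projection M U) (unit_column M j)))\<^sup>2)"
    by (intro Max_ge) auto
  then show ?thesis
    unfolding norm_projection_unit_column[symmetric] coherence_def
    by (simp add: mult_left_mono)
qed

text \<open>The squared entries of the slices add up to \<open>n2\<close> each, and the coherence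
  bounds every row's share of the total \<open>n2 n3\<close>. This keeps the scale
  \<open>n1 R\<close> of the main proof at least 1.\<close>

lemma coherence_ge:
  "real CARD('n2) * real CARD('n3) \<le> c\<^sup>2 * real CARD('n2) * coherence M U"
proof -
  have "(\<Sum>j\<in>UNIV. (norm (tensor_slice M U k $ j))\<^sup>2) = real CARD('n2)" for k
  proof -
    have "(\<Sum>j\<in>UNIV. (norm (tensor_slice M U k $ j))\<^sup>2)
        = trace (\<Sum>j\<in>UNIV. outer (tensor_slice M U k $ j))"
      by (simp add: power2_norm_eq_inner inner_vec_def trace_def outer_def sum_component)
        (rule sum.swap)
    then show ?thesis by (simp add: sum_outer_rows trace_I)
  qed
  then have "real CARD('n2) * real CARD('n3)
      = (\<Sum>k\<in>(UNIV :: 'n3 set). \<Sum>j\<in>UNIV. (norm (tensor_slice M U k $ j))\<^sup>2)"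
    by simp
  also have "\<dots> = (\<Sum>j\<in>UNIV. \<Sum>k\<in>UNIV. (norm (tensor_slice M U k $ j))\<^sup>2)"
    by (rule sum.swap)
  also have "\<dots> \<le> (\<Sum>j\<in>(UNIV :: 'n1 set). c\<^sup>2 * real CARD('n2) * coherence M U / real CARD('n1))"
    by (intro sum_mono sum_norm_rows_le_coherence)
  also have "\<dots> = c\<^sup>2 * real CARD('n2) * coherence M U" by simp
  finally show ?thesis .
qed

lemma residual_eq_orthogonal_part:
  assumes "X \<in> column_subspace M U" "Y \<in> orthogonal_subspace M U"
  shows "(X + Y) - tensor_prod M (projection M U) (X + Y) = Y"
proof -
  have "tensor_slice M ((X + Y) - tensor_prod M (projection M U) (X + Y)) k = tensor_slice M Y k"
    for k
  proof -
    let ?A = "tensor_slice M U k"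
    obtain C where X: "tensor_slice M X k = ?A ** C"
      using column_subspace_slice[OF inv assms(1)] by blast
    have Y: "transpose ?A ** tensor_slice M Y k = 0"
      by (rule slice_orthogonal[OF assms(2)])
    have "?A ** transpose ?A ** (?A ** C + tensor_slice M Y k)
        = ?A ** ((transpose ?A ** ?A) ** C) + ?A ** (transpose ?A ** tensor_slice M Y k)"
      by (simp only: matrix_add_ldistrib matrix_mul_assoc)
    also have "\<dots> = ?A ** C"
      by (simp add: slice_orthonormal Y)
    finally show ?thesis
      by (simp add: tensor_slice_diff tensor_slice_add tensor_slice_prod[OF inv]
          slice_projection_orthonormal X)
  qed
  then show ?thesis by (simp add: tensor_eq_iff_slices[OF inv])
qed

end

text \<open>Summand \<open>j\<close> stacks, over all slices, the share of row \<open>j\<close> in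
  \<open>A_k^T y_k\<close>, which vanishes in total by orthogonality. Treating the slices as one
  long vector spares the vector inequality a union bound, so no dimension enters \<beta>.\<close>

lemma sum_orthogonal_rows:
  assumes "Y \<in> orthogonal_subspace M U"
  shows "(\<Sum>j\<in>UNIV. (\<chi> k. (M *v (Y $ j $ 1)) $ k *\<^sub>R tensor_slice M U k $ j)) = 0"
proof -
  have "(\<Sum>j\<in>UNIV. tensor_slice M U k $ j $ s * tensor_slice M Y k $ j $ 1) = 0" for k s
    using slice_orthogonal[OF assms, of k]
    by (simp add: vec_eq_iff matrix_matrix_mult_def transpose_def)
  then show ?thesis
    by (simp add: vec_eq_iff tensor_slice_nth sum_component mult.commute)
qed

text \<open>The frame bound is strict so that the Gram matrices are invertible even for
  \<open>s = 0\<close>, the case \<gamma> = 1; only the lower estimate divides by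
  \<open>s\<close>.\<close>

lemma sample_residual:
  fixes \<Omega> :: "'m::finite \<Rightarrow> 'n1" and X Y :: "real ^ 'n3 ^ 1 ^ 'n1"
  assumes X: "X \<in> column_subspace M U" and "0 \<le> s"
    and frame: "\<And>k v. v \<noteq> 0 \<Longrightarrow> s * (norm v)\<^sup>2 < (\<Sum>i\<in>UNIV. (tensor_slice M U k $ \<Omega> i \<bullet> v)\<^sup>2)"
  defines "UO \<equiv> tubal_restrict \<Omega> U" and "TO \<equiv> tubal_restrict \<Omega> (X + Y)"
    and "y \<equiv> \<lambda>j. M *v (Y $ j $ 1)"
  shows "tensor_invertible M (tensor_prod M (tensor_transpose M UO) UO)"
    and "c\<^sup>2 * (norm (TO - tensor_prod M (projection M UO) TO))\<^sup>2 \<le> (\<Sum>i\<in>UNIV. (norm (y (\<Omega> i)))\<^sup>2)"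
    and "0 < s \<Longrightarrow> (\<Sum>i\<in>UNIV. (norm (y (\<Omega> i)))\<^sup>2)
        - (norm (\<Sum>i\<in>UNIV. (\<chi> k. y (\<Omega> i) $ k *\<^sub>R tensor_slice M U k $ \<Omega> i)))\<^sup>2 / s
      \<le> c\<^sup>2 * (norm (TO - tensor_prod M (projection M UO) TO))\<^sup>2"
proof -
  define A where "A = (\<lambda>k. tensor_slice M UO k)"
  define b where "b = (\<lambda>k. \<chi> i. y (\<Omega> i) $ k)"
  have A_nth: "A k $ i = tensor_slice M U k $ \<Omega> i" for k i
    by (simp add: A_def UO_def tensor_slice_restrict)
  have A_mult: "(norm (A k *v v))\<^sup>2 = (\<Sum>i\<in>UNIV. (tensor_slice M U k $ \<Omega> i \<bullet> v)\<^sup>2)" for k v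
    by (simp add: norm_square_vec matrix_vector_mult_def inner_vec_def A_nth)
  have G: "tensor_slice M (tensor_prod M (tensor_transpose M UO) UO) k = transpose (A k) ** A k" for k
    by (simp add: A_def tensor_slice_prod[OF inv] tensor_slice_transpose[OF inv])
  have "invertible (transpose (A k) ** A k)" for k
  proof -
    have "v = 0" if "(transpose (A k) ** A k) *v v = 0" for v
    proof (rule ccontr)
      assume "v \<noteq> 0"
      have "(A k *v v) \<bullet> (A k *v v) = v \<bullet> (transpose (A k) *v (A k *v v))"
        by (metis dot_lmul_matrix inner_commute transpose_matrix_vector)
      then have "(norm (A k *v v))\<^sup>2 = 0"
        using that by (simp only: power2_norm_eq_inner matrix_vector_mul_assoc inner_zero_right)
      moreover have "0 \<le> s * (norm v)\<^sup>2" using \<open>0 \<le> s\<close> by simp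
      ultimately show False using frame[OF \<open>v \<noteq> 0\<close>, of k] A_mult[of k v] by linarith
    qed
    then show ?thesis
      using matrix_left_invertible_ker[of "transpose (A k) ** A k"] invertible_left_inverse by blast
  qed
  then show inv': "tensor_invertible M (tensor_prod M (tensor_transpose M UO) UO)"
    by (simp add: tensor_invertible_iff[OF inv] G)
  define H where "H = (\<lambda>k. tensor_slice M (tensor_inv M (tensor_prod M (tensor_transpose M UO) UO)) k)"
  have H: "(transpose (A k) ** A k) ** H k = mat 1" for k
    unfolding H_def G[symmetric] by (rule tensor_slice_inv[OF inv inv'])
  have res: "column 1 (tensor_slice M (TO - tensor_prod M (projection M UO) TO) k)
      = b k - (A k ** H k ** transpose (A k)) *v b k" for k
  proof -
    obtain C where C: "tensor_slice M X k = tensor_slice M U k ** C"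
      using column_subspace_slice[OF inv X] by blast
    \<comment> \<open>Sampling the rows of \<open>U_k C\<close> gives \<open>A k ** C\<close>, so
      the sampled \<open>X\<close> lies in the range of \<open>A k\<close> and drops out of the
      residual.\<close>
    have "column 1 (tensor_slice M TO k) = b k + A k *v column 1 C"
      by (simp add: vec_eq_iff column_def TO_def tensor_slice_restrict tensor_slice_add C b_def y_def
          tensor_slice_nth[of M Y] matrix_matrix_mult_def matrix_vector_mult_def A_nth)
    moreover have "tensor_slice M (projection M UO) k = A k ** H k ** transpose (A k)"
      by (simp only: A_def H_def tensor_slice_projection[OF inv])
    ultimately show ?thesis
      by (simp only: tensor_slice_diff column_diff tensor_slice_prod[OF inv] column_mult
          residual_invariant[OF H])
  qed
  have err: "c\<^sup>2 * (norm (TO - tensor_prod M (projection M UO) TO))\<^sup>2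
      = (\<Sum>k\<in>UNIV. (norm (b k - (A k ** H k ** transpose (A k)) *v b k))\<^sup>2)"
    by (simp add: norm_column_tensor_slices res)
  have sum_b: "(\<Sum>k\<in>UNIV. (norm (b k))\<^sup>2) = (\<Sum>i\<in>UNIV. (norm (y (\<Omega> i)))\<^sup>2)"
    unfolding norm_square_vec b_def by (simp add: sum.swap[of _ "UNIV :: 'm set"])
  show "c\<^sup>2 * (norm (TO - tensor_prod M (projection M UO) TO))\<^sup>2 \<le> (\<Sum>i\<in>UNIV. (norm (y (\<Omega> i)))\<^sup>2)"
    unfolding err sum_b[symmetric] by (intro sum_mono norm_residual_le H)
  assume "0 < s"
  have low: "s * (norm v)\<^sup>2 \<le> (norm (A k *v v))\<^sup>2" for k v
    using frame[of v k] A_mult[of k v] by (cases "v = 0") auto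
  have "(norm (\<Sum>i\<in>UNIV. (\<chi> k. y (\<Omega> i) $ k *\<^sub>R tensor_slice M U k $ \<Omega> i)))\<^sup>2
      = (\<Sum>k\<in>UNIV. (norm (transpose (A k) *v b k))\<^sup>2)"
  proof -
    have "(\<Sum>i\<in>UNIV. (\<chi> k. y (\<Omega> i) $ k *\<^sub>R tensor_slice M U k $ \<Omega> i)) $ k
        = transpose (A k) *v b k" for k
      by (simp add: vec_eq_iff sum_component matrix_vector_mult_def transpose_def A_nth b_def
          mult.commute)
    then show ?thesis by (subst norm_square_vec) simp
  qed
  then have "(\<Sum>i\<in>UNIV. (norm (y (\<Omega> i)))\<^sup>2)
        - (norm (\<Sum>i\<in>UNIV. (\<chi> k. y (\<Omega> i) $ k *\<^sub>R tensor_slice M U k $ \<Omega> i)))\<^sup>2 / s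
      = (\<Sum>k\<in>UNIV. (norm (b k))\<^sup>2 - (norm (transpose (A k) *v b k))\<^sup>2 / s)"
    by (simp only: sum_b sum_subtractf sum_divide_distrib)
  also have "\<dots> \<le> c\<^sup>2 * (norm (TO - tensor_prod M (projection M UO) TO))\<^sup>2"
    unfolding err by (intro sum_mono norm_residual_ge H \<open>0 < s\<close> low)
  finally show "(\<Sum>i\<in>UNIV. (norm (y (\<Omega> i)))\<^sup>2)
        - (norm (\<Sum>i\<in>UNIV. (\<chi> k. y (\<Omega> i) $ k *\<^sub>R tensor_slice M U k $ \<Omega> i)))\<^sup>2 / s
      \<le> c\<^sup>2 * (norm (TO - tensor_prod M (projection M UO) TO))\<^sup>2" .
qed

end

theorem theorem1:
  fixes M :: "real ^ 'n3 ^ 'n3"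
    and U :: "real ^ 'n3 ^ 'n2 ^ 'n1"
    and T X Y :: "real ^ 'n3 ^ 1 ^ 'n1"
    and c \<delta> \<mu> \<alpha> \<beta> \<gamma> m n1 n2 n3 :: real
  assumes dims: "m = real CARD('m :: finite)" "n1 = real CARD('n1)"
      "n2 = real CARD('n2)" "n3 = real CARD('n3)"
    and transform: "invertible M" "\<And>a. norm (M *v a) = c * norm a"
      "0 < c" "c \<le> onorm (\<lambda>a. M *v a)"
    and orthonormal: "tensor_prod M (tensor_transpose M U) U = tensor_id M"
    and decomposition: "T = X + Y" "X \<in> column_subspace M U" "Y \<in> orthogonal_subspace M U"
    and mu: "\<mu> = coherence M U"
    and delta: "\<delta> > 0"
    and sample_size: "m \<ge> 8 / 3 * n2 * \<mu> * ln (2 * n2 * n3 / \<delta>)"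
    and alpha: "\<alpha> =
      sqrt (2 * (n1 * (max_tube_norm Y)\<^sup>2 - (norm Y)\<^sup>2) / (m * (norm Y)\<^sup>2) * ln (1 / \<delta>))
      + 2 * (n1 * (max_tube_norm Y)\<^sup>2 - (norm Y)\<^sup>2) / (3 * m * (norm Y)\<^sup>2) * ln (1 / \<delta>)"
    and beta: "\<beta> = (1 + 2 * sqrt (ln (1 / \<delta>)))\<^sup>2"
    and gamma: "\<gamma> = sqrt (8 * c\<^sup>2 * n2 * \<mu> / (3 * m) * ln (2 * n2 * n3 / \<delta>))"
    and gamma_le: "\<gamma> \<le> 1"
  shows "measure_pmf.prob (tubal_sample :: ('m \<Rightarrow> 'n1) pmf)
     {\<Omega>. let U\<^sub>\<Omega> = tubal_restrict \<Omega> U; T\<^sub>\<Omega> = tubal_restrict \<Omega> T;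
            err = (norm (T - tensor_prod M (projection M U) T))\<^sup>2;
            err\<^sub>\<Omega> = (norm (T\<^sub>\<Omega> - tensor_prod M (projection M U\<^sub>\<Omega>) T\<^sub>\<Omega>))\<^sup>2
        in tensor_invertible M (tensor_prod M (tensor_transpose M U\<^sub>\<Omega>) U\<^sub>\<Omega>) \<and>
           (\<gamma> < 1 \<longrightarrow>
              (m * (1 - \<alpha>) - c\<^sup>2 * n2 * \<mu> * (\<beta> / (1 - \<gamma>))) / n1 * err \<le> err\<^sub>\<Omega>) \<and>
           err\<^sub>\<Omega> \<le> (1 + \<alpha>) * (m / n1) * err}
     \<ge> 1 - 4 * \<delta>"
proof (cases "1 / 4 \<le> \<delta>")
  \<comment> \<open>Here the claimed probability is not positive. For smaller
    \<open>\<delta>\<close>, \<open>exp 1 \<le> 3\<close> gives \<open>l \<ge> 1\<close>.\<close>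
  case True
  then have "1 - 4 * \<delta> \<le> 0" by simp
  then show ?thesis by (rule order_trans) (rule measure_nonneg)
next
  case False
  let ?q = "Pi_pmf (UNIV :: 'm set) undefined (\<lambda>_. pmf_of_set (UNIV :: 'n1 set))"
  define l where "l = ln (1 / \<delta>)"
  define L where "L = ln (2 * n2 * n3 / \<delta>)"
  \<comment> \<open>By coherence, the squared lengths of row \<open>j\<close> in all transformed
    slices of \<open>U\<close> add up to at most \<open>R\<close>.\<close>
  define R where "R = c\<^sup>2 * n2 * \<mu> / n1"
  define u where "u = (\<lambda>k j. tensor_slice M U k $ j)"
  define y where "y = (\<lambda>j. M *v (Y $ j $ 1))"
  define z where "z = (\<lambda>j. (norm (y j))\<^sup>2)"
  define Z where "Z = c\<^sup>2 * (max_tube_norm Y)\<^sup>2"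
  define S where "S = c\<^sup>2 * (norm Y)\<^sup>2"
  define x where "x = (\<lambda>j. \<chi> k. y j $ k *\<^sub>R u k j)"
  have pos: "0 < m" "1 \<le> n1" "1 \<le> n2" "1 \<le> n3"
    using zero_less_card_finite by (simp_all add: dims Suc_le_eq)
  have n23: "1 \<le> n2 * n3" using mult_mono[of 1 n2 1 n3] pos by simp
  have l1: "1 \<le> l"
  proof -
    have "exp 1 \<le> 1 / \<delta>"
      using False delta mult_mono[of \<delta> "1 / 4" "exp 1" 3] exp_le by (simp add: field_simps)
    then show ?thesis
      using delta by (simp add: l_def ln_ge_iff)
  qed
  have exp_l: "exp (- l) = \<delta>"
    using delta by (simp add: l_def exp_minus)
  have lL: "l \<le> L"
    unfolding l_def L_def using delta n23 by (simp add: divide_right_mono)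
  have n1R: "n1 * R = c\<^sup>2 * n2 * \<mu>" using pos by (simp add: R_def)
  have n1R_ge: "1 \<le> n1 * R"
  proof -
    have "n2 * n3 \<le> c\<^sup>2 * n2 * \<mu>"
      using coherence_ge[OF transform(1,2,3) orthonormal] by (simp only: dims mu)
    then show ?thesis using n23 n1R by linarith
  qed
  then have "0 < n1 * R" by linarith
  then have R: "0 < R" using pos by (simp add: zero_less_mult_iff)
  have \<gamma>_eq: "\<gamma> = sqrt (8 * (n1 * R) / (3 * m) * L)"
    unfolding gamma n1R L_def by (simp only: mult.assoc)
  have \<gamma>_sq: "0 \<le> 8 * (n1 * R) / (3 * m) * L"
    using R pos lL l1 by (intro mult_nonneg_nonneg divide_nonneg_nonneg) auto
  then have \<gamma>0: "0 \<le> \<gamma>" unfolding \<gamma>_eq by (rule real_sqrt_ge_zero)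
  have \<gamma>2: "\<gamma>\<^sup>2 * m = 8 / 3 * (n1 * R) * L"
    using pos \<gamma>_sq unfolding \<gamma>_eq by (simp only: real_sqrt_pow2) simp
  have m_ge: "8 / 3 * l \<le> m"
  proof -
    have "1 * l \<le> n1 * R * L" using n1R_ge lL l1 by (intro mult_mono) auto
    moreover have "\<gamma>\<^sup>2 * m \<le> 1 * m"
      using gamma_le \<gamma>0 pos by (intro mult_right_mono power_le_one) auto
    ultimately show ?thesis using \<gamma>2 by linarith
  qed
  have u_sum: "(\<Sum>k\<in>UNIV. (norm (u k j))\<^sup>2) \<le> R" for j
    using sum_norm_rows_le_coherence[OF transform(1,2,3) orthonormal, of j]
    by (simp add: u_def R_def dims mu)
  have u_le: "(norm (u k j))\<^sup>2 \<le> R" for k j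
    using u_sum[of j] member_le_sum[of k UNIV "\<lambda>k. (norm (u k j))\<^sup>2"] by simp
  have iso: "(\<Sum>j\<in>UNIV. outer (u k j)) = mat 1" for k
    unfolding u_def by (rule sum_outer_rows[OF transform(1,2,3) orthonormal])
  have x_sum: "(\<Sum>j\<in>UNIV. x j) = 0"
    unfolding x_def u_def y_def
    by (rule sum_orthogonal_rows[OF transform(1,2,3) decomposition(3)])
  have x_le: "(norm (x j))\<^sup>2 \<le> R * z j" for j
  proof -
    have "(norm (x j))\<^sup>2 = (\<Sum>k\<in>UNIV. (y j $ k)\<^sup>2 * (norm (u k j))\<^sup>2)"
      by (subst norm_square_vec) (simp add: x_def power_mult_distrib)
    also have "\<dots> \<le> (\<Sum>k\<in>UNIV. (y j $ k)\<^sup>2 * R)"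
      by (intro sum_mono mult_left_mono u_le) simp
    also have "\<dots> = R * z j"
      by (simp add: z_def norm_square_vec[of "y j"] sum_distrib_left mult.commute)
    finally show ?thesis .
  qed
  have z0: "0 \<le> z j" for j by (simp add: z_def)
  have zZ: "z j \<le> Z" for j
  proof -
    have "norm (Y $ j $ 1) \<le> max_tube_norm Y"
      unfolding max_tube_norm_def by (intro Max_ge) auto
    then show ?thesis
      unfolding z_def Z_def y_def transform(2) power_mult_distrib
      by (intro mult_left_mono power_mono) auto
  qed
  have S_sum: "S = (\<Sum>j\<in>UNIV. z j)"
    unfolding S_def z_def y_def by (rule norm_column_tensor[OF transform(1,2,3)])
  have S0: "0 < S" if "Y \<noteq> 0" using that transform(3) by (simp add: S_def)
  \<comment> \<open>The ratio inside \<alpha>; the factor \<open>c^2\<close> of the transform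
    cancels.\<close>
  define v where "v = n1 * Z / S - 1"
  have alpha': "\<alpha> = sqrt (2 * v / m * l) + 2 * v / (3 * m) * l" if "Y \<noteq> 0"
  proof -
    have "v = (n1 * (max_tube_norm Y)\<^sup>2 - (norm Y)\<^sup>2) / (norm Y)\<^sup>2"
      using that transform(3) by (simp add: v_def Z_def S_def diff_divide_distrib)
    then have "2 * v / m = 2 * (n1 * (max_tube_norm Y)\<^sup>2 - (norm Y)\<^sup>2) / (m * (norm Y)\<^sup>2)"
      "2 * v / (3 * m) = 2 * (n1 * (max_tube_norm Y)\<^sup>2 - (norm Y)\<^sup>2) / (3 * m * (norm Y)\<^sup>2)"
      by (simp_all add: mult_ac)
    then show ?thesis unfolding alpha l_def by simp
  qed

  \<comment> \<open>The four failure events and their probabilities\<close>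
  let ?B1 = "{f :: 'm \<Rightarrow> 'n1. \<exists>k w. w \<noteq> 0 \<and> (\<Sum>i\<in>UNIV. (u k (f i) \<bullet> w)\<^sup>2)
    \<le> (1 - \<gamma>) * (m / n1) * (norm w)\<^sup>2}"
  let ?B2 = "{f :: 'm \<Rightarrow> 'n1. Y \<noteq> 0 \<and> (1 + \<alpha>) * (m / n1) * S < (\<Sum>i\<in>UNIV. z (f i))}"
  let ?B3 = "{f :: 'm \<Rightarrow> 'n1. Y \<noteq> 0 \<and> (\<Sum>i\<in>UNIV. z (f i)) < (m * (1 - \<alpha>) - 2 / 3 * l) / n1 * S}"
  let ?B4 = "{f :: 'm \<Rightarrow> 'n1. Y \<noteq> 0 \<and> \<alpha> < 1 \<and>
    m / n1 * R * (\<beta> - 2 / 3 * l) * S < (norm (\<Sum>i\<in>UNIV. x (f i)))\<^sup>2}"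
  have B1: "measure_pmf.prob ?q ?B1 \<le> \<delta>"
    unfolding dims
  proof (rule prob_frames_lower_bound_le[OF iso u_le R \<gamma>0 gamma_le delta])
    show "\<delta> \<le> 1" using False by simp
    \<comment> \<open>The matrix bound asks for the constant 2 where \<open>\<gamma>^2\<close>
      contains 8/3.\<close>
    have "n1 * R * L * 2 \<le> n1 * R * L * (8 / 3)"
      using R pos lL l1 by (intro mult_left_mono mult_nonneg_nonneg) auto
    then have "2 * n1 * R * L \<le> \<gamma>\<^sup>2 * m" unfolding \<gamma>2 by (simp add: mult_ac)
    then show "2 * real CARD('n1) * R * ln (2 * real CARD('n2) * real CARD('n3) / \<delta>)
        \<le> \<gamma>\<^sup>2 * real CARD('m)"
      by (simp only: L_def dims)
  qed
  have B2: "measure_pmf.prob ?q ?B2 \<le> \<delta>"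
  proof (cases "Y = 0")
    case Y: False
    have "0 < l" using l1 by simp
    from prob_sample_sum_tails(1)[OF z0 zZ S_sum S0[OF Y] this alpha'[OF Y, unfolded v_def dims]]
    show ?thesis by (simp add: Y exp_l dims)
  qed (use delta in simp)
  have B3: "measure_pmf.prob ?q ?B3 \<le> \<delta>"
  proof (cases "Y = 0")
    case Y: False
    have "0 < l" using l1 by simp
    from prob_sample_sum_tails(2)[OF z0 zZ S_sum S0[OF Y] this alpha'[OF Y, unfolded v_def dims]]
    show ?thesis by (simp add: Y exp_l dims)
  qed (use delta in simp)
  have B4: "measure_pmf.prob ?q ?B4 \<le> \<delta>"
  proof (cases "Y \<noteq> 0 \<and> \<alpha> < 1")
    case Y: True
    have v0: "0 \<le> v"
      unfolding v_def dims(2) using Y by (intro variance_nonneg[OF z0 zZ S_sum S0 zero_less_one]) simp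
    \<comment> \<open>\<alpha> = \<open>sqrt (2 w) + 2/3 w < 1\<close> forces
      \<open>w < 1/2\<close>. The concentration ratio \<open>l n1 Z / (m S)\<close> equals
      \<open>w + l / m\<close>, and \<open>l / m \<le> 3/8\<close> keeps it below 1.\<close>
    define w where "w = v / m * l"
    have w0: "0 \<le> w" using v0 l1 pos by (simp add: w_def)
    have "\<alpha> = sqrt (2 * w) + 2 / 3 * w"
      using alpha' Y by (simp add: w_def mult.assoc)
    then have "sqrt (2 * w) < 1" using Y w0 by linarith
    then have "w < 1 / 2" by simp
    moreover have "l / m \<le> 3 / 8" using m_ge pos by (simp add: field_simps)
    moreover have "l * (n1 * Z) / (m * S) = w + l / m"
      using S0 Y pos by (simp add: w_def v_def field_simps)
    ultimately have "l * (n1 * Z) / (m * S) \<le> 1" by linarith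
    then have small: "l * (n1 * Z) \<le> m * S"
      using S0 Y pos by (simp add: pos_divide_le_eq)
    have "measure_pmf.prob ?q {f. real CARD('m) / real CARD('n1) * R * ((1 + 2 * sqrt l)\<^sup>2 - 2 / 3 * l) * S
            < (norm (\<Sum>i\<in>UNIV. x (f i)))\<^sup>2} \<le> exp (- l)"
      using S0 Y small
      by (intro prob_norm_sample_sum_gt[OF x_sum x_le zZ S_sum _ R l1]) (auto simp: dims)
    then show ?thesis using Y by (simp add: exp_l dims beta flip: l_def)
  next
    case False
    then have empty: "?B4 = {}" by blast
    show ?thesis unfolding empty using delta by simp
  qed
  let ?E = "{\<Omega>. let U\<^sub>\<Omega> = tubal_restrict \<Omega> U; T\<^sub>\<Omega> = tubal_restrict \<Omega> T;
            err = (norm (T - tensor_prod M (projection M U) T))\<^sup>2;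
            err\<^sub>\<Omega> = (norm (T\<^sub>\<Omega> - tensor_prod M (projection M U\<^sub>\<Omega>) T\<^sub>\<Omega>))\<^sup>2
        in tensor_invertible M (tensor_prod M (tensor_transpose M U\<^sub>\<Omega>) U\<^sub>\<Omega>) \<and>
           (\<gamma> < 1 \<longrightarrow>
              (m * (1 - \<alpha>) - c\<^sup>2 * n2 * \<mu> * (\<beta> / (1 - \<gamma>))) / n1 * err \<le> err\<^sub>\<Omega>) \<and>
           err\<^sub>\<Omega> \<le> (1 + \<alpha>) * (m / n1) * err}"

  \<comment> \<open>The deterministic estimate outside the failure events\<close>
  have good: "\<Omega> \<in> ?E" if "\<Omega> \<notin> ?B1" "\<Omega> \<notin> ?B2" "\<Omega> \<notin> ?B3" "\<Omega> \<notin> ?B4" for \<Omega> :: "'m \<Rightarrow> 'n1"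
  proof -
    let ?UO = "tubal_restrict \<Omega> U" and ?TO = "tubal_restrict \<Omega> T"
    let ?err = "(norm (?TO - tensor_prod M (projection M ?UO) ?TO))\<^sup>2"
    let ?s = "(1 - \<gamma>) * (m / n1)"
    let ?\<Sigma> = "\<Sum>i\<in>UNIV. z (\<Omega> i)"
    have s0: "0 \<le> ?s" using gamma_le pos by simp
    have frame: "?s * (norm w)\<^sup>2 < (\<Sum>i\<in>UNIV. (tensor_slice M U k $ \<Omega> i \<bullet> w)\<^sup>2)" if "w \<noteq> 0" for k w
      using \<open>\<Omega> \<notin> ?B1\<close> that by (auto simp: u_def not_le)
    note sample = decomposition(2) s0 frame
    have invertible: "tensor_invertible M (tensor_prod M (tensor_transpose M ?UO) ?UO)"
      by (rule sample_residual(1)[OF transform(1,2,3) sample])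
    have residual_le: "c\<^sup>2 * ?err \<le> ?\<Sigma>"
      unfolding z_def y_def decomposition(1)
      by (rule sample_residual(2)[OF transform(1,2,3) sample])
    have residual_ge: "?\<Sigma> - (norm (\<Sum>i\<in>UNIV. x (\<Omega> i)))\<^sup>2 / ?s \<le> c\<^sup>2 * ?err" if "0 < ?s"
      unfolding z_def x_def y_def u_def decomposition(1)
      by (rule sample_residual(3)[OF transform(1,2,3) sample that])
    have err: "(norm (T - tensor_prod M (projection M U) T))\<^sup>2 = (norm Y)\<^sup>2"
      unfolding decomposition(1)
      by (subst residual_eq_orthogonal_part[OF transform(1,2,3) orthonormal decomposition(2,3)]) simp
    have c2: "0 < c\<^sup>2" using transform(3) by simp
    have upper: "?err \<le> (1 + \<alpha>) * (m / n1) * (norm Y)\<^sup>2"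
    proof -
      have "?\<Sigma> \<le> (1 + \<alpha>) * (m / n1) * S"
      proof (cases "Y = 0")
        case True
        then show ?thesis by (simp add: S_def z_def y_def)
      next
        case Y: False
        then show ?thesis using \<open>\<Omega> \<notin> ?B2\<close> by simp
      qed
      then have "c\<^sup>2 * ?err \<le> c\<^sup>2 * ((1 + \<alpha>) * (m / n1) * (norm Y)\<^sup>2)"
        using residual_le by (simp add: S_def mult_ac)
      then show ?thesis using c2 by (rule mult_left_le_imp_le)
    qed
    have lower: "(m * (1 - \<alpha>) - c\<^sup>2 * n2 * \<mu> * (\<beta> / (1 - \<gamma>))) / n1 * (norm Y)\<^sup>2 \<le> ?err" if "\<gamma> < 1"
    proof -
      have b0: "0 \<le> n1 * R * (\<beta> / (1 - \<gamma>))"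
        using n1R_ge that by (simp add: beta)
      consider "Y = 0" | "Y \<noteq> 0" "1 \<le> \<alpha>" | "Y \<noteq> 0" "\<alpha> < 1" by linarith
      then show ?thesis
      proof cases
        case 1
        then show ?thesis by simp
      next
        case 2
        then have "m * (1 - \<alpha>) - n1 * R * (\<beta> / (1 - \<gamma>)) \<le> 0"
          using b0 pos mult_nonneg_nonpos[of m "1 - \<alpha>"] by linarith
        then have "(m * (1 - \<alpha>) - n1 * R * (\<beta> / (1 - \<gamma>))) / n1 * (norm Y)\<^sup>2 \<le> 0"
          using pos by (intro mult_nonpos_nonneg divide_nonpos_nonneg) auto
        then show ?thesis unfolding n1R by (rule order_trans) simp
      next
        case 3
        have s: "0 < ?s" using that pos by simp
        have split: "(a - n1 * b) / n1 * S = a / n1 * S - b * S" for a b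
          using pos by (simp add: diff_divide_distrib left_diff_distrib)
        let ?W = "(norm (\<Sum>i\<in>UNIV. x (\<Omega> i)))\<^sup>2"
        have "?W / ?s \<le> m / n1 * R * (\<beta> - 2 / 3 * l) * S / ?s"
          using \<open>\<Omega> \<notin> ?B4\<close> 3 s by (intro divide_right_mono) auto
        also have "\<dots> = R * (\<beta> - 2 / 3 * l) / (1 - \<gamma>) * S"
          using that pos by (simp add: field_simps)
        finally have W: "?W / ?s \<le> R * (\<beta> - 2 / 3 * l) / (1 - \<gamma>) * S" .
        \<comment> \<open>The trade: since \<open>n1 R / (1 - \<gamma>) \<ge> 1\<close>, the
          \<open>2/3 l\<close> saved in \<beta> outweighs the \<open>2/3 l\<close> lost in the lower
          tail.\<close>
        have "1 - \<gamma> \<le> n1 * R" by (rule order_trans[OF _ n1R_ge]) (simp add: \<gamma>0)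
        then have "1 \<le> n1 * R / (1 - \<gamma>)" using that by (simp add: pos_le_divide_eq)
        then have "1 * (2 / 3 * l) \<le> n1 * R / (1 - \<gamma>) * (2 / 3 * l)"
          using l1 by (intro mult_right_mono) auto
        then have "(m * (1 - \<alpha>) - n1 * R * (\<beta> / (1 - \<gamma>)))
          \<le> (m * (1 - \<alpha>) - 2 / 3 * l) - n1 * (R * (\<beta> - 2 / 3 * l) / (1 - \<gamma>))"
          by (simp add: algebra_simps diff_divide_distrib)
        then have "(m * (1 - \<alpha>) - n1 * R * (\<beta> / (1 - \<gamma>))) / n1 * S
          \<le> ((m * (1 - \<alpha>) - 2 / 3 * l) - n1 * (R * (\<beta> - 2 / 3 * l) / (1 - \<gamma>))) / n1 * S"
          using pos S0 3 by (intro mult_right_mono divide_right_mono) auto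
        also have "\<dots> = (m * (1 - \<alpha>) - 2 / 3 * l) / n1 * S - R * (\<beta> - 2 / 3 * l) / (1 - \<gamma>) * S"
          by (rule split)
        also have "\<dots> \<le> ?\<Sigma> - ?W / ?s"
          using \<open>\<Omega> \<notin> ?B3\<close> 3 W by (intro diff_mono) auto
        also have "\<dots> \<le> c\<^sup>2 * ?err" by (rule residual_ge[OF s])
        finally have "c\<^sup>2 * ((m * (1 - \<alpha>) - n1 * R * (\<beta> / (1 - \<gamma>))) / n1 * (norm Y)\<^sup>2) \<le> c\<^sup>2 * ?err"
          by (simp add: S_def mult_ac)
        then show ?thesis using c2 unfolding n1R by (rule mult_left_le_imp_le)
      qed
    qed
    show ?thesis
      using invertible upper lower by (simp add: err Let_def)
  qed
  have "1 - measure_pmf.prob ?q ?E = measure_pmf.prob ?q (- ?E)"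
    by (simp add: measure_pmf.prob_compl[of ?E, simplified] Compl_eq_Diff_UNIV)
  also have "\<dots> \<le> measure_pmf.prob ?q ((?B1 \<union> ?B2) \<union> (?B3 \<union> ?B4))"
    by (intro measure_pmf.finite_measure_mono) (use good in blast, simp)
  also have "\<dots> \<le> (measure_pmf.prob ?q ?B1 + measure_pmf.prob ?q ?B2)
      + (measure_pmf.prob ?q ?B3 + measure_pmf.prob ?q ?B4)"
    by (intro order_trans[OF measure_Un_le] add_mono measure_Un_le) auto
  also have "\<dots> \<le> 4 * \<delta>" using B1 B2 B3 B4 by linarith
  finally show ?thesis by (simp add: tubal_sample_def)
qed

end
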